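(* For any two centrally symmetric convex bodies $K,L\subset\mathbb R^2$, $$\operatorname{vol}(K)\cdot\left(2\operatorname{vol}(L)+\int_{S^{1}}\frac{h_L^2}{h_K}\,dS_K\right)-4\,V(L,K)^2\le 0 .$$ (This is the case $n=2$, $p=0$ of the local $L^p$-Brunn-Minkowski inequality $\operatorname{vol}(K)\big(n(n-1)V(L[2],K[n-2])+(1-p)\int_{S^{n-1}}\frac{h_L^2}{h_K}dS_K\big)-n(n-p)V(L,K[n-1])^2\le0$.)
   Context: A convex body is a compact convex set with nonempty interior; it is centrally symmetric if $K=-K$. The support function of $K$ is $h_K(u)=\max_{y\in K}\langle u,y\rangle$. The surface area measure $S_K$ is the Borel measure on the unit sphere $S^{n-1}$ given by $S_K(\omega)=\mathcal H^{n-1}(\nu_K^{-1}(\omega))$, where $\nu_K$ is the ($\mathcal H^{n-1}$-a.e. defined on $\partial K$) Gauss map sending a boundary point to its unique outer unit normal. The mixed volumes $V(K[i],L[n-i])$ are defined by $\operatorname{vol}(K+tL)=\sum_{i=0}^n\binom ni V(K[i],L[n-i])\,t^{n-i}$ for $t\ge0$; in the plane, $\operatorname{vol}(K+tL)=\operatorname{vol}(K)+2tV(L,K)+t^2\operatorname{vol}(L)$. *)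

theory Defs
  imports "HOL-Analysis.Analysis"
begin

definition convex_body :: "'a::euclidean_space set \<Rightarrow> bool" where
  "convex_body K \<longleftrightarrow> compact K \<and> convex K \<and> interior K \<noteq> {}"

definition centrally_symmetric :: "'a::euclidean_space set \<Rightarrow> bool" where
  "centrally_symmetric K \<longleftrightarrow> uminus ` K = K"

text \<open>For nonempty compact K the supremum is attained, so it is the maximum.\<close>

definition support_fun :: "'a::euclidean_space set \<Rightarrow> 'a \<Rightarrow> real" where
  "support_fun K u = (SUP y\<in>K. u \<bullet> y)"

text \<open>
  The d-dimensional Hausdorff (outer) measure, with the normalisation that makes it agree with
  Lebesgue measure in d-dimensional Euclidean space; for d = 1 the weight of a covering set is
  exactly its diameter. Covers are restricted to bounded sets because \<^const>\<open>diameter\<close> is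
  unspecified otherwise, and the empty set is given weight 0 so that d = 0 yields counting measure.
\<close>

definition hausdorff_weight :: "nat \<Rightarrow> 'a::euclidean_space set \<Rightarrow> ennreal" where
  "hausdorff_weight d U =
     (if U = {} then 0 else ennreal (unit_ball_vol (real d) * (diameter U / 2) ^ d))"

definition hausdorff_pre_measure :: "nat \<Rightarrow> real \<Rightarrow> 'a::euclidean_space set \<Rightarrow> ennreal" where
  "hausdorff_pre_measure d \<delta> A =
     (INF U \<in> {U :: nat \<Rightarrow> 'a set. A \<subseteq> (\<Union>i. U i) \<and> (\<forall>i. bounded (U i) \<and> diameter (U i) \<le> \<delta>)}.
        (\<Sum>i. hausdorff_weight d (U i)))"

definition hausdorff_outer_measure :: "nat \<Rightarrow> 'a::euclidean_space set \<Rightarrow> ennreal" where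
  "hausdorff_outer_measure d A = (SUP \<delta>\<in>{0<..}. hausdorff_pre_measure d \<delta> A)"

definition outer_unit_normal :: "'a::euclidean_space set \<Rightarrow> 'a \<Rightarrow> 'a \<Rightarrow> bool" where
  "outer_unit_normal K x u \<longleftrightarrow> norm u = 1 \<and> (\<forall>y\<in>K. u \<bullet> y \<le> u \<bullet> x)"

definition regular_boundary :: "'a::euclidean_space set \<Rightarrow> 'a set" where
  "regular_boundary K = {x \<in> frontier K. \<exists>!u. outer_unit_normal K x u}"

text \<open>Meaningful only on \<^term>\<open>regular_boundary K\<close>, which is the domain of the Gauss map.\<close>

definition gauss_map :: "'a::euclidean_space set \<Rightarrow> 'a \<Rightarrow> 'a" where
  "gauss_map K x = (THE u. outer_unit_normal K x u)"

definition surface_area_measure :: "'a::euclidean_space set \<Rightarrow> 'a measure" where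
  "surface_area_measure K =
     measure_of (sphere 0 1) (sets (restrict_space borel (sphere (0::'a) 1)))
       (\<lambda>\<omega>. hausdorff_outer_measure (DIM('a) - 1) {x \<in> regular_boundary K. gauss_map K x \<in> \<omega>})"

abbreviation vol :: "'a::euclidean_space set \<Rightarrow> real" where
  "vol K \<equiv> measure lebesgue K"

text \<open>
  The planar mixed volume V(L,K), as the coefficient in the expansion of vol(K + tL);
  it is determined by the case t = 1.
\<close>

definition mixed_area :: "(real^2) set \<Rightarrow> (real^2) set \<Rightarrow> real" where
  "mixed_area L K =
     (THE v. \<forall>t\<ge>0. vol {x + t *\<^sub>R y |x y. x \<in> K \<and> y \<in> L} = vol K + 2 * t * v + t\<^sup>2 * vol L)"

end

theory Submission
  imports Defs
begin

text \<open>
  The theorem is an integrated form of Bonnesen's inequality. If two symmetric planar bodies have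
  the same width in a direction u, then they have the same projection to the line spanned by u, and a
  comparison of the slices orthogonal to u gives vol (K + L) \<ge> 2 vol K + 2 vol L. For K and the dilate
  of L that has the same width as K in the direction u this becomes
  
      h_K(u)^2 vol L + h_L(u)^2 vol K \<le> 2 h_K(u) h_L(u) V(L,K)
  
  for every unit vector u (Bonnesen_symmetric). Dividing by h_K(u) and integrating over S_K yields
  
      vol K \<integral> h_L^2 / h_K dS_K \<le> 2 V(L,K) \<integral> h_L dS_K - vol L \<integral> h_K dS_K,
  
  and the theorem follows from \<integral> h_L dS_K \<le> 2 V(L,K) and \<integral> h_K dS_K \<ge> 2 vol K
  (integral_support_fun_le and vol_le_integral_support_fun).
  
  The mixed area is accessible through support points. Let x_j and y_j be support points of K and L
  in the direction at angle j \<pi> / m. The shoelace sums of the x_j converge to the area of K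
  (sum_cross_tendsto_vol), and x_j + t y_j is a support point of K + t L. So vol (K + t L) is a limit of
  quadratic polynomials in t, which shows that the mixed area is well defined (vol_msum), and 2 V(L,K) is
  the limit of the coefficients of t (grid_mixed_tendsto). Summation by parts turns these into sums over
  the edges x_{j+1} - x_j of the length of the edge times the value of h_L at its normal.
  
  The surface area measure enters through arcs of directions of length \<pi> / m. The boundary points of K
  with normals in such an arc form a flat Lipschitz graph over the corresponding edge, so the Hausdorff
  measure is at most slightly larger than the length of the edge (hausdorff_gauss_preimage_le); this
  gives the first integral bound. Conversely, a set of such boundary points of diameter d spans with the
  origin a cone of area at most about h_K d / 2 (cone_subset_triangle). The cones over the regular
  boundary points cover K up to a null set, as only countably many boundary points have more than one
  normal (countable_nonregular); this gives the second integral bound.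
  
  If the set function that defines S_K were not countably additive, then S_K would be the zero measure
  by convention, and the claim would be Minkowski's inequality vol K vol L \<le> V(L,K)^2, which is again a
  consequence of Bonnesen's inequality.
\<close>

section \<open>Coordinates in the plane\<close>

definition perp :: "real^2 \<Rightarrow> real^2" where
  "perp v = vector [- v$2, v$1]"

definition dir :: "real \<Rightarrow> real^2" where
  "dir \<theta> = vector [cos \<theta>, sin \<theta>]"

text \<open>
  The signed area of the parallelogram spanned by two vectors.
\<close>

definition cross :: "real^2 \<Rightarrow> real^2 \<Rightarrow> real" where
  "cross a b = a$1 * b$2 - a$2 * b$1"

lemma inner_coords: "(a::real^2) \<bullet> b = a$1 * b$1 + a$2 * b$2"
  by (simp add: inner_vec_def sum_2)

lemma vec2_eq_iff: "(a::real^2) = b \<longleftrightarrow> a$1 = b$1 \<and> a$2 = b$2"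
  by (simp add: vec_eq_iff forall_2)

lemmas coords = inner_coords vec2_eq_iff perp_def dir_def cross_def

lemma norm_dir [simp]: "norm (dir t) = 1"
  by (simp add: norm_eq_1 coords flip: power2_eq_square)

lemma cross_dir: "cross (dir s) (dir t) = sin (t - s)"
  by (simp add: coords sin_diff)

lemma dir_diff_le: "norm (dir s - dir t) \<le> \<bar>s - t\<bar>"
proof -
  have "(norm (dir s - dir t))\<^sup>2 = 2 - 2 * cos (s - t)"
  proof -
    have "(norm (dir s - dir t))\<^sup>2 = (dir s - dir t) \<bullet> (dir s - dir t)" by (rule power2_norm_eq_inner)
    also have "\<dots> = ((sin s)\<^sup>2 + (cos s)\<^sup>2) + ((sin t)\<^sup>2 + (cos t)\<^sup>2) - 2 * (cos s * cos t + sin s * sin t)"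
      by (simp add: coords power2_eq_square algebra_simps)
    finally show ?thesis by (simp add: cos_diff)
  qed
  also have "\<dots> = (2 * sin ((s - t) / 2))\<^sup>2"
    using cos_double_sin[of "(s - t) / 2"] unfolding mult_2 field_sum_of_halves
    by (simp add: power_mult_distrib)
  also have "\<dots> \<le> \<bar>s - t\<bar>\<^sup>2"
  proof -
    have "\<bar>sin ((s - t) / 2)\<bar> \<le> \<bar>(s - t) / 2\<bar>" by (rule abs_sin_x_le_abs_x)
    then have "\<bar>2 * sin ((s - t) / 2)\<bar> \<le> \<bar>s - t\<bar>" by simp
    then show ?thesis by (metis abs_le_square_iff abs_abs)
  qed
  finally show ?thesis by (rule power2_le_imp_le) simp
qed

lemma cross_Lagrange: "cross a b * cross c d = (a \<bullet> c) * (b \<bullet> d) - (a \<bullet> d) * (b \<bullet> c)"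
  by (simp add: coords) algebra

lemma cross_eq_perp: "cross a b = perp a \<bullet> b"
  by (simp add: coords)

lemma cross_commute: "cross a b = - cross b a"
  by (simp add: coords)

lemma cross_self [simp]: "cross a a = 0"
  by (simp add: coords)

lemma cross_zero [simp]: "cross 0 a = 0" "cross a 0 = 0"
  by (simp_all add: coords)

lemma cross_minus [simp]: "cross (- a) b = - cross a b" "cross a (- b) = - cross a b"
  by (simp_all add: coords)

lemma perp_eq_0_iff [simp]: "perp a = 0 \<longleftrightarrow> a = 0"
  by (auto simp: coords)

lemma perp_minus [simp]: "perp (- u) = - perp u"
  by (simp add: coords)

lemma dir_nonzero [simp]: "dir t \<noteq> 0"
  by (metis norm_dir norm_zero zero_neq_one)

lemma dir_add_pi [simp]: "dir (t + pi) = - dir t"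
  by (simp add: coords)

text \<open>
  Cramer's rule in the plane.
\<close>

lemma cross_basis_expansion:
  assumes "cross p q \<noteq> 0"
  shows "z = (cross z q / cross p q) *\<^sub>R p + (cross p z / cross p q) *\<^sub>R q"
proof -
  have "cross p q *\<^sub>R z = cross z q *\<^sub>R p + cross p z *\<^sub>R q"
    by (simp add: coords algebra_simps)
  then have "(1 / cross p q) *\<^sub>R (cross p q *\<^sub>R z) = (1 / cross p q) *\<^sub>R (cross z q *\<^sub>R p + cross p z *\<^sub>R q)"
    by simp
  then show ?thesis using assms by (simp add: scaleR_add_right)
qed

lemma inner_perp_eqI:
  assumes "u \<noteq> 0" "u \<bullet> x = u \<bullet> y" "perp u \<bullet> x = perp u \<bullet> y"
  shows "x = y"
proof -
  have "(u \<bullet> u) * (x$1) = u$1 * (u \<bullet> x) - u$2 * (perp u \<bullet> x)" for x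
    by (simp add: coords) algebra
  moreover have "(u \<bullet> u) * (x$2) = u$2 * (u \<bullet> x) + u$1 * (perp u \<bullet> x)" for x
    by (simp add: coords) algebra
  ultimately have "(u \<bullet> u) * (x$1) = (u \<bullet> u) * (y$1)" "(u \<bullet> u) * (x$2) = (u \<bullet> u) * (y$2)"
    using assms by simp_all
  moreover have "u \<bullet> u \<noteq> 0" using assms(1) by simp
  ultimately show ?thesis by (simp add: vec2_eq_iff del: inner_eq_zero_iff)
qed

lemma dir_inner_shift: "dir (a + t) \<bullet> e = cos t * (dir a \<bullet> e) + sin t * cross (dir a) e"
  by (simp add: coords sin_add cos_add algebra_simps)

lemma norm_dir_decompose: "(norm e)\<^sup>2 = (dir a \<bullet> e)\<^sup>2 + (cross (dir a) e)\<^sup>2"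
proof -
  have "(dir a \<bullet> e)\<^sup>2 + (cross (dir a) e)\<^sup>2 = ((sin a)\<^sup>2 + (cos a)\<^sup>2) * (e \<bullet> e)"
    by (simp add: coords del: sin_cos_squared_add sin_cos_squared_add2) algebra
  then show ?thesis by (simp add: power2_norm_eq_inner)
qed

lemma negligible_line: "a \<noteq> 0 \<Longrightarrow> negligible {z. cross a z = 0}"
  unfolding cross_eq_perp by (rule negligible_hyperplane) simp

lemma vol_scale: "vol ((*\<^sub>R) s ` (L :: (real^2) set)) = s\<^sup>2 * vol L"
  using measure_lebesgue_affine[of s "0 :: real^2" L] by simp

section \<open>Bonnesen's inequality for bodies of equal width\<close>

lemma continuous_vector_Pair: "continuous_on UNIV (\<lambda>(x, y). vector [x, y] :: real^2)"
proof -
  have "continuous_on UNIV (\<lambda>p::real \<times> real. if i = 1 then fst p else snd p)" for i :: 2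
    by (cases "i = 1") (auto intro!: continuous_intros)
  then have "continuous_on UNIV (\<lambda>p::real \<times> real. (\<chi> i. if i = 1 then fst p else snd p) :: real^2)"
    by (rule continuous_on_vec_lambda)
  moreover have "(\<lambda>(x, y). vector [x, y] :: real^2) = (\<lambda>p. \<chi> i. if i = 1 then fst p else snd p)"
    by (auto simp: vec_eq_iff forall_2 split: prod.splits)
  ultimately show ?thesis by simp
qed

text \<open>
  Transfers Fubini's theorem from pairs of reals to column vectors.
\<close>

lemma lborel_plane_eq_distr:
  "lborel = distr (lborel :: (real \<times> real) measure) borel (\<lambda>(x, y). vector [x, y] :: real^2)"
proof (rule lborel_eqI)
  have meas: "(\<lambda>(x, y). vector [x, y] :: real^2) \<in> borel_measurable borel"
    by (rule borel_measurable_continuous_onI[OF continuous_vector_Pair])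
  show "sets (distr (lborel :: (real \<times> real) measure) borel (\<lambda>(x, y). vector [x, y] :: real^2)) = sets borel"
    by simp
  fix l u :: "real^2"
  assume le: "\<And>b. b \<in> Basis \<Longrightarrow> l \<bullet> b \<le> u \<bullet> b"
  have le1: "l$i \<le> u$i" for i
    using le[of "axis i 1"] by (auto simp: Basis_vec_def inner_axis)
  have box: "(\<lambda>(x, y). vector [x, y] :: real^2) -` box l u = box (l$1, l$2) (u$1, u$2)"
    by (auto simp: mem_box_cart forall_2 mem_box(1)[of _ "(_, _)"] Basis_prod_def ball_Un)
  have "emeasure (distr (lborel :: (real \<times> real) measure) borel (\<lambda>(x, y). vector [x, y] :: real^2)) (box l u)
      = emeasure lborel (box (l$1, l$2) (u$1, u$2))"
    using meas by (subst emeasure_distr) (simp_all add: box)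
  also have "\<dots> = ennreal ((u$1 - l$1) * (u$2 - l$2))"
    using le1 by (subst emeasure_lborel_box) (auto simp: Basis_prod_def prod.union_disjoint image_iff inner_Pair)
  also have "(u$1 - l$1) * (u$2 - l$2) = (\<Prod>b\<in>Basis. (u - l) \<bullet> b)"
  proof -
    have B: "(Basis :: (real^2) set) = {axis 1 1, axis 2 1}"
      by (auto simp: Basis_vec_def UNIV_2)
    have "axis 1 1 \<noteq> (axis 2 1 :: real^2)" by (simp add: axis_eq_axis)
    then show ?thesis by (simp add: B inner_axis)
  qed
  finally show "emeasure (distr (lborel :: (real \<times> real) measure) borel (\<lambda>(x, y). vector [x, y] :: real^2)) (box l u)
      = ennreal (\<Prod>b\<in>Basis. (u - l) \<bullet> b)" .
qed

definition slice :: "(real^2) set \<Rightarrow> real \<Rightarrow> real set" where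
  "slice K s = {y. vector [s, y] \<in> K}"

lemma
  fixes K :: "(real^2) set"
  assumes K: "K \<in> sets borel"
  shows emeasure_eq_slices: "emeasure lborel K = (\<integral>\<^sup>+ s. emeasure lborel (slice K s) \<partial>lborel)"
    and measurable_slices: "(\<lambda>s. emeasure lborel (slice K s)) \<in> borel_measurable borel"
proof -
  let ?f = "\<lambda>(x, y). vector [x, y] :: real^2"
  have meas: "?f \<in> borel_measurable borel"
    by (rule borel_measurable_continuous_onI[OF continuous_vector_Pair])
  have P: "?f -` K \<in> sets (lborel \<Otimes>\<^sub>M lborel)"
    using measurable_sets_borel[OF meas K] by (simp only: lborel_prod sets_lborel)
  have sl: "Pair s -` (?f -` K) = slice K s" for s
    by (auto simp: slice_def)
  have "emeasure lborel K = emeasure lborel (?f -` K)"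
    using meas K by (subst lborel_plane_eq_distr, subst emeasure_distr) auto
  also have "\<dots> = emeasure (lborel \<Otimes>\<^sub>M lborel) (?f -` K)" by (simp add: lborel_prod)
  also have "\<dots> = (\<integral>\<^sup>+ s. emeasure lborel (slice K s) \<partial>lborel)"
    using lborel.emeasure_pair_measure_alt[OF P] by (simp only: sl)
  finally show "emeasure lborel K = (\<integral>\<^sup>+ s. emeasure lborel (slice K s) \<partial>lborel)" .
  show "(\<lambda>s. emeasure lborel (slice K s)) \<in> borel_measurable borel"
    using lborel.measurable_emeasure_Pair[OF P] by (simp only: sl) simp
qed

lemma compact_slice: "compact K \<Longrightarrow> compact (slice K s)"
proof -
  assume K: "compact K"
  have c: "continuous_on UNIV (\<lambda>y. vector [s, y] :: real^2)"
    using continuous_on_compose2[OF continuous_vector_Pair continuous_on_Pair[OF continuous_on_const continuous_on_id], of s UNIV]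
    by simp
  have "closed ((\<lambda>y. vector [s, y] :: real^2) -` K)"
    by (rule closed_vimage[OF compact_imp_closed[OF K]]) (simp add: c)
  then have "closed (slice K s)" by (simp add: slice_def vimage_def)
  moreover have "slice K s \<subseteq> (\<lambda>x. x $ 2) ` K"
    by (force simp: slice_def image_iff intro: bexI[of _ "vector [s, _]"])
  then have "bounded (slice K s)"
    by (rule bounded_subset[rotated])
       (intro compact_imp_bounded compact_continuous_image K continuous_intros)
  ultimately show ?thesis by (simp add: compact_eq_bounded_closed)
qed

lemma convex_slice: "convex K \<Longrightarrow> convex (slice K s)"
proof (rule convexI)
  fix y z a b :: real
  assume K: "convex K" and "y \<in> slice K s" "z \<in> slice K s" and ab: "0 \<le> a" "0 \<le> b" "a + b = 1"
  then have "a *\<^sub>R (vector [s, y] :: real^2) + b *\<^sub>R vector [s, z] \<in> K"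
    by (auto intro: convexD simp: slice_def)
  also have "a *\<^sub>R (vector [s, y] :: real^2) + b *\<^sub>R vector [s, z] = vector [s, a *\<^sub>R y + b *\<^sub>R z]"
    using ab by (simp add: vec2_eq_iff flip: distrib_right)
  finally show "a *\<^sub>R y + b *\<^sub>R z \<in> slice K s" by (simp add: slice_def)
qed

lemma emeasure_interval_sum_le:
  fixes A B C :: "real set"
  assumes A: "compact A" "convex A" "A \<noteq> {}" and B: "compact B" "convex B" "B \<noteq> {}"
    and C: "C \<in> sets borel" "\<And>x y. x \<in> A \<Longrightarrow> y \<in> B \<Longrightarrow> x + y \<in> C"
  shows "emeasure lborel A + emeasure lborel B \<le> emeasure lborel C"
proof -
  obtain a b where ab: "A = {a..b}"
    using A connected_compact_interval_1 convex_connected by metis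
  obtain c d where cd: "B = {c..d}"
    using B connected_compact_interval_1 convex_connected by metis
  have le: "a \<le> b" "c \<le> d" using ab cd A B by auto
  have "{a + c..b + d} \<subseteq> C"
  proof
    fix z assume z: "z \<in> {a + c..b + d}"
    define x where "x = min b (z - c)"
    have "x \<in> A" "z - x \<in> B" using z le by (auto simp: x_def ab cd min_def)
    then show "z \<in> C" using C(2)[of x "z - x"] by simp
  qed
  then have "emeasure lborel {a + c..b + d} \<le> emeasure lborel C"
    by (intro emeasure_mono) (use C in auto)
  then show ?thesis using le
    by (simp add: ab cd flip: ennreal_plus) (simp add: algebra_simps)
qed

lemma vol_eq_emeasure:
  fixes K :: "'a::euclidean_space set"
  assumes "compact K"
  shows "ennreal (vol K) = emeasure lborel K"
proof -
  have "emeasure lborel K \<noteq> \<infinity>"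
    using emeasure_compact_finite[OF assms] by simp
  then show ?thesis
    using borel_compact[OF assms] by (simp add: emeasure_eq_ennreal_measure)
qed

text \<open>
  At height 2s the sum K + L contains the sum of the slices of K and L at height s. Since the
  projections agree, both slices are nonempty intervals or both are empty, so the lengths add up; the
  change of variables from s to 2s produces the factor 2.
\<close>

lemma vol_sum_equal_projection:
  fixes K L :: "(real^2) set"
  assumes K: "compact K" "convex K" and L: "compact L" "convex L"
    and proj: "(\<lambda>x. x$1) ` K = (\<lambda>x. x$1) ` L"
  shows "2 * vol K + 2 * vol L \<le> vol {x + y |x y. x \<in> K \<and> y \<in> L}"
proof -
  define M where "M = {x + y |x y. x \<in> K \<and> y \<in> L}"
  have M: "compact M" unfolding M_def by (rule compact_sums[OF K(1) L(1)])
  note [measurable] = measurable_slices[OF borel_compact[OF K(1)]] measurable_slices[OF borel_compact[OF L(1)]]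
    measurable_slices[OF borel_compact[OF M]]
  have slice_le: "emeasure lborel (slice K s) + emeasure lborel (slice L s) \<le> emeasure lborel (slice M (2 * s))" for s
  proof (cases "s \<in> (\<lambda>x. x$1) ` K")
    case True
    have ne: "slice S s \<noteq> {}" if "s \<in> (\<lambda>x. x$1) ` S" for S
    proof -
      from that obtain x where x: "x \<in> S" "s = x$1" by auto
      have "vector [s, x$2] = x" by (simp add: vec2_eq_iff x)
      then have "x$2 \<in> slice S s" using x(1) by (simp add: slice_def)
      then show ?thesis by blast
    qed
    show ?thesis
    proof (rule emeasure_interval_sum_le)
      fix x y assume "x \<in> slice K s" "y \<in> slice L s"
      then have "vector [s, x] + vector [s, y] \<in> M" by (auto simp: slice_def M_def)
      also have "vector [s, x] + vector [s, y] = (vector [2 * s, x + y] :: real^2)"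
        by (simp add: vec2_eq_iff)
      finally show "x + y \<in> slice M (2 * s)" by (simp add: slice_def)
    qed (use K L M True proj ne in \<open>auto intro!: compact_slice convex_slice borel_compact\<close>)
  next
    case False
    have "slice S s = {}" if "s \<notin> (\<lambda>x. x$1) ` S" for S
      using that by (force simp: slice_def)
    then show ?thesis using False proj by auto
  qed
  have "2 * (emeasure lborel K + emeasure lborel L)
      = 2 * (\<integral>\<^sup>+ s. emeasure lborel (slice K s) + emeasure lborel (slice L s) \<partial>lborel)"
    using K L by (simp add: emeasure_eq_slices borel_compact nn_integral_add)
  also have "\<dots> \<le> 2 * (\<integral>\<^sup>+ s. emeasure lborel (slice M (2 * s)) \<partial>lborel)"
    by (intro mult_left_mono nn_integral_mono slice_le) simp
  also have "\<dots> = (\<integral>\<^sup>+ s. emeasure lborel (slice M s) \<partial>lborel)"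
    using nn_integral_real_affine[of "\<lambda>s. emeasure lborel (slice M s)" 2 0] by simp
  also have "\<dots> = emeasure lborel M" using M by (simp add: emeasure_eq_slices borel_compact)
  finally have "2 * (ennreal (vol K) + ennreal (vol L)) \<le> ennreal (vol M)"
    using K L M by (simp add: vol_eq_emeasure)
  then have "ennreal (2 * vol K + 2 * vol L) \<le> ennreal (vol M)"
    by (simp add: distrib_left ennreal_plus ennreal_mult)
  then show ?thesis unfolding M_def by (subst (asm) ennreal_le_iff) auto
qed

text \<open>
  A rotation takes u to the first coordinate direction.
\<close>

lemma vol_sum_equal_width:
  fixes K L :: "(real^2) set"
  assumes K: "compact K" "convex K" and L: "compact L" "convex L" and u: "norm u = 1"
    and proj: "(\<lambda>x. u \<bullet> x) ` K = (\<lambda>x. u \<bullet> x) ` L"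
  shows "2 * vol K + 2 * vol L \<le> vol {x + y |x y. x \<in> K \<and> y \<in> L}"
proof -
  define f where "f x = (vector [u \<bullet> x, perp u \<bullet> x] :: real^2)" for x
  have u1: "u$1 * u$1 + u$2 * u$2 = 1" using u by (simp add: norm_eq_1 inner_coords)
  have lin: "linear f"
    by (rule linearI) (auto simp: f_def coords algebra_simps)
  have "f v \<bullet> f w = v \<bullet> w" for v w
  proof -
    have "f v \<bullet> f w = (u$1 * u$1 + u$2 * u$2) * (v \<bullet> w)"
      by (simp add: f_def coords) algebra
    then show ?thesis by (simp add: u1)
  qed
  with lin have orth: "orthogonal_transformation f" by (simp add: orthogonal_transformation_def)
  have vol: "vol (f ` S) = vol S" if "compact S" for S
    using measure_orthogonal_image[OF orth lmeasurable_compact[OF that]] .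
  have cpt: "compact (f ` S)" if "compact S" for S
    using lin that by (intro compact_continuous_image linear_continuous_on linear_conv_bounded_linear[THEN iffD1])
  have sum: "f ` {x + y |x y. x \<in> K \<and> y \<in> L} = {x + y |x y. x \<in> f ` K \<and> y \<in> f ` L}"
    by (auto simp: linear_add[OF lin] image_iff) (metis linear_add[OF lin])+
  have "2 * vol (f ` K) + 2 * vol (f ` L) \<le> vol {x + y |x y. x \<in> f ` K \<and> y \<in> f ` L}"
    by (rule vol_sum_equal_projection)
       (use K L proj in \<open>simp_all add: cpt convex_linear_image lin image_image, simp add: f_def\<close>)
  then show ?thesis
    using K L by (simp add: vol compact_sums flip: sum)
qed

section \<open>Symmetric convex bodies and their support points\<close>

definition support_point :: "'a::euclidean_space set \<Rightarrow> 'a \<Rightarrow> 'a \<Rightarrow> bool" where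
  "support_point K u x \<longleftrightarrow> x \<in> K \<and> (\<forall>y\<in>K. u \<bullet> y \<le> u \<bullet> x)"

definition sym_body :: "'a::euclidean_space set \<Rightarrow> bool" where
  "sym_body K \<longleftrightarrow> convex_body K \<and> centrally_symmetric K"

lemma
  assumes "sym_body K"
  shows sym_body_compact: "compact K" and sym_body_convex: "convex K"
    and sym_body_interior: "interior K \<noteq> {}"
    and sym_body_uminus: "x \<in> K \<Longrightarrow> - x \<in> K"
  using assms by (auto simp: sym_body_def convex_body_def centrally_symmetric_def)

lemma sym_body_uminus_image: "sym_body K \<Longrightarrow> uminus ` K = K"
  by (simp add: sym_body_def centrally_symmetric_def)

lemma sym_body_zero_interior:
  assumes K: "sym_body K"
  shows "0 \<in> interior K"
proof -
  obtain x where x: "x \<in> interior K" using sym_body_interior[OF K] by blast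
  have "interior K = uminus ` interior K"
    using interior_negations[of K] sym_body_uminus_image[OF K] by simp
  with x have "- x \<in> interior K" by blast
  then have "(1/2) *\<^sub>R x + (1/2) *\<^sub>R (- x) \<in> interior K"
    by (intro convexD[OF convex_interior[OF sym_body_convex[OF K]]] x) auto
  then show ?thesis by simp
qed

lemma sym_body_radii:
  assumes K: "sym_body K"
  obtains r R where "0 < r" "cball 0 r \<subseteq> K" "0 < R" "\<And>x. x \<in> K \<Longrightarrow> norm x \<le> R"
proof -
  obtain r where r: "0 < r" "cball 0 r \<subseteq> K"
    using sym_body_zero_interior[OF K] mem_interior_cball by blast
  obtain R where R: "\<And>x. x \<in> K \<Longrightarrow> norm x \<le> R" "0 < R"
    using compact_imp_bounded[OF sym_body_compact[OF K]] bounded_pos by blast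
  show ?thesis by (rule that[OF r R(2,1)])
qed

lemma sym_body_nonempty: "sym_body K \<Longrightarrow> K \<noteq> {}"
  using sym_body_interior interior_subset by blast

lemma support_point_exists:
  assumes "compact K" "K \<noteq> {}"
  obtains x where "support_point K u x"
proof -
  have "continuous_on K (\<lambda>y. u \<bullet> y)" by (intro continuous_intros)
  from continuous_attains_sup[OF assms this] that show ?thesis
    by (auto simp: support_point_def)
qed

lemma support_fun_eq:
  assumes "support_point K u x"
  shows "support_fun K u = u \<bullet> x"
  unfolding support_fun_def
  by (rule cSup_eq_maximum) (use assms in \<open>auto simp: support_point_def\<close>)

lemma inner_le_support_fun:
  assumes "compact K" "x \<in> K"
  shows "u \<bullet> x \<le> support_fun K u"
proof -
  obtain y where "support_point K u y" using assms by (auto intro: support_point_exists)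
  then show ?thesis using assms by (simp add: support_fun_eq) (simp add: support_point_def)
qed

lemma abs_inner_le_support_fun:
  assumes K: "sym_body K" and x: "x \<in> K"
  shows "\<bar>u \<bullet> x\<bar> \<le> support_fun K u"
  using inner_le_support_fun[OF sym_body_compact[OF K] x, of u]
    inner_le_support_fun[OF sym_body_compact[OF K] sym_body_uminus[OF K x], of u]
  by simp

lemma support_point_uminus:
  assumes K: "sym_body K" and x: "support_point K u x"
  shows "support_point K (- u) (- x)"
  unfolding support_point_def
proof (intro conjI ballI)
  show "- x \<in> K" using x sym_body_uminus[OF K] by (simp add: support_point_def)
  fix y assume "y \<in> K"
  then show "- u \<bullet> y \<le> - u \<bullet> - x"
    using x sym_body_uminus[OF K] by (auto simp: support_point_def) (metis inner_minus_right)
qed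

lemma support_fun_uminus:
  assumes K: "sym_body K"
  shows "support_fun K (- u) = support_fun K u"
proof -
  obtain x where x: "support_point K u x"
    using support_point_exists sym_body_compact[OF K] sym_body_nonempty[OF K] by blast
  then show ?thesis using support_point_uminus[OF K x] by (simp add: support_fun_eq)
qed

lemma support_fun_lower:
  assumes "compact K" "cball 0 r \<subseteq> K" "0 \<le> r" "norm u = 1"
  shows "r \<le> support_fun K u"
proof -
  have "r *\<^sub>R u \<in> K" using assms by auto
  from inner_le_support_fun[OF assms(1) this, of u] show ?thesis
    using assms by (simp add: norm_eq_1)
qed

lemma support_fun_Lipschitz:
  assumes K: "compact K" "K \<noteq> {}" and R: "\<And>x. x \<in> K \<Longrightarrow> norm x \<le> R"
  shows "support_fun K u \<le> support_fun K v + R * norm (u - v)"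
proof -
  obtain x where x: "support_point K u x" using support_point_exists[OF K] .
  then have "support_fun K u = v \<bullet> x + (u - v) \<bullet> x"
    by (simp add: support_fun_eq inner_diff_left)
  moreover have "v \<bullet> x \<le> support_fun K v"
    using x K by (intro inner_le_support_fun) (auto simp: support_point_def)
  moreover have "(u - v) \<bullet> x \<le> norm (u - v) * norm x" by (rule norm_cauchy_schwarz)
  moreover have "norm (u - v) * norm x \<le> norm (u - v) * R"
    using R x by (intro mult_left_mono) (auto simp: support_point_def)
  ultimately show ?thesis by (simp add: mult.commute)
qed

section \<open>Area as a limit of shoelace sums\<close>

text \<open>
  Support points turn in the same sense as their normals. By symmetry \<bar>u \<bullet> b\<bar> \<le> u \<bullet> a and
  \<bar>v \<bullet> a\<bar> \<le> v \<bullet> b, so the right-hand side of Lagrange's identity is nonnegative.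
\<close>

lemma cross_support_points_nonneg:
  assumes K: "sym_body K" and a: "support_point K u a" and b: "support_point K v b"
    and uv: "0 < cross u v"
  shows "0 \<le> cross a b"
proof -
  have aK: "a \<in> K" and bK: "b \<in> K" using a b by (auto simp: support_point_def)
  have "\<bar>u \<bullet> b\<bar> \<le> u \<bullet> a" "\<bar>v \<bullet> a\<bar> \<le> v \<bullet> b"
    using abs_inner_le_support_fun[OF K bK, of u] abs_inner_le_support_fun[OF K aK, of v]
    by (simp_all add: support_fun_eq[OF a] support_fun_eq[OF b])
  then have "\<bar>u \<bullet> b\<bar> * \<bar>v \<bullet> a\<bar> \<le> (u \<bullet> a) * (v \<bullet> b)" by (intro mult_mono) auto
  then have "(u \<bullet> b) * (v \<bullet> a) \<le> (u \<bullet> a) * (v \<bullet> b)"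
    by (metis abs_mult abs_ge_self order_trans)
  then have "0 \<le> cross a b * cross u v"
    by (simp add: cross_Lagrange[of a b] inner_commute mult.commute)
  then show ?thesis using uv by (simp add: zero_le_mult_iff)
qed

text \<open>
  Support points for the directions at angles 0, \<pi>/m, ..., \<pi>. Closing the sequence
  antipodally makes the points and their negatives the vertices of an inscribed symmetric polygon.
\<close>

definition support_seq :: "(real^2) set \<Rightarrow> nat \<Rightarrow> (nat \<Rightarrow> real^2) \<Rightarrow> bool" where
  "support_seq K m x \<longleftrightarrow>
     (\<forall>j\<le>m. support_point K (dir (j * (pi / m))) (x j)) \<and> x m = - x 0"

abbreviation triangle0 :: "real^2 \<Rightarrow> real^2 \<Rightarrow> (real^2) set" where
  "triangle0 a b \<equiv> convex hull {0, a, b}"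

lemma triangle0_compact [simp]: "compact (triangle0 a b)"
  by (intro finite_imp_compact_convex_hull) auto

lemma vol_triangle0: "vol (triangle0 a b) = \<bar>cross a b\<bar> / 2"
proof -
  have "vol (triangle0 a b) = measure lborel (triangle0 a b)"
    by (intro measure_completion) (simp add: borel_compact)
  then show ?thesis using content_triangle[of 0 a b] by (simp add: cross_def abs_minus_commute mult.commute)
qed

lemma triangle0_halfplane:
  assumes "0 \<le> cross p a" "0 \<le> cross p b"
  shows "triangle0 a b \<subseteq> {z. 0 \<le> cross p z}"
proof (rule hull_minimal)
  show "convex {z. 0 \<le> cross p z}"
    using convex_halfspace_ge[of 0 "perp p"] by (simp add: cross_eq_perp)
qed (use assms in auto)

lemma triangle0_halfplane':
  assumes "0 \<le> cross a p" "0 \<le> cross b p"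
  shows "triangle0 a b \<subseteq> {z. 0 \<le> cross z p}"
  using triangle0_halfplane[of "-p" a b] assms cross_commute[of p] by auto

lemma support_seq_cross_nonneg:
  assumes K: "sym_body K" and x: "support_seq K m x" and ik: "i \<le> k" "k \<le> m"
  shows "0 \<le> cross (x i) (x k)"
proof -
  consider "i = k" | "i < k" "k - i < m" | "i = 0" "k = m"
    using ik by linarith
  then show ?thesis
  proof cases
    case 2
    then have m: "0 < m" by simp
    have "0 < sin ((real k - real i) * (pi / m))"
    proof (rule sin_gt_zero)
      show "0 < (real k - real i) * (pi / m)" using 2 m by simp
      have "real k - real i < m" using 2 by linarith
      then have "(real k - real i) * (pi / m) < m * (pi / m)"
        using m by (intro mult_strict_right_mono) auto
      then show "(real k - real i) * (pi / m) < pi" using m by simp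
    qed
    then have "0 < cross (dir (i * (pi / m))) (dir (k * (pi / m)))"
      by (simp add: cross_dir algebra_simps)
    then show ?thesis
      using x ik by (intro cross_support_points_nonneg[OF K]) (auto simp: support_seq_def)
  next
    case 3
    then show ?thesis using x by (simp add: support_seq_def)
  qed auto
qed

lemma support_seq_nonzero:
  assumes K: "sym_body K" and x: "support_seq K m x" and j: "j \<le> m"
  shows "x j \<noteq> 0"
proof
  assume 0: "x j = 0"
  obtain r R where "0 < r" "cball 0 r \<subseteq> K" using sym_body_radii[OF K] by metis
  then have "r \<le> support_fun K (dir (j * (pi / m)))"
    by (intro support_fun_lower sym_body_compact[OF K]) auto
  also have "\<dots> = 0"
    using x j by (subst support_fun_eq[of _ _ "x j"]) (auto simp: support_seq_def 0)
  finally show False using \<open>0 < r\<close> by simp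
qed

text \<open>
  The triangles with vertices 0, x j, x (j + 1) lie in K, and the line through 0 and x k separates the
  triangle number k from all earlier ones, because cross (x i) (x k) \<ge> 0 for i \<le> k. The line through
  x 0 separates all of them from their reflections. So twice the total area of these triangles is at
  most the area of K.
\<close>

lemma sum_cross_le_vol:
  assumes K: "sym_body K" and x: "support_seq K m x"
  shows "(\<Sum>j<m. cross (x j) (x (Suc j))) \<le> vol K"
proof -
  define T where "T j = triangle0 (x j) (x (Suc j))" for j
  have nn: "0 \<le> cross (x i) (x k)" if "i \<le> k" "k \<le> m" for i k
    by (rule support_seq_cross_nonneg[OF K x that])
  have TK: "T j \<subseteq> K" if "j < m" for j
    unfolding T_def using x that sym_body_zero_interior[OF K] interior_subset[of K]
    by (intro hull_minimal sym_body_convex[OF K]) (auto simp: support_seq_def support_point_def)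
  have Tm: "T j \<in> lmeasurable" for j
    by (simp add: T_def lmeasurable_compact)
  define A where "A = (\<Union>j<m. T j)"
  have Am: "A \<in> lmeasurable" using Tm by (auto simp: A_def)
  have "pairwise (\<lambda>i k. negligible (T i \<inter> T k)) {..<m}"
  proof (rule pairwiseI)
    have *: "negligible (T i \<inter> T k)" if "i < k" "k < m" for i k
    proof (rule negligible_subset[OF negligible_line[OF support_seq_nonzero[OF K x, of k]]])
      have "T i \<subseteq> {z. 0 \<le> cross z (x k)}" "T k \<subseteq> {z. 0 \<le> cross (x k) z}"
        unfolding T_def using that by (intro triangle0_halfplane triangle0_halfplane' nn; simp)+
      then show "T i \<inter> T k \<subseteq> {z. cross (x k) z = 0}"
        using cross_commute[of "x k"] by force
    qed (use that in auto)
    fix i k assume "i \<in> {..<m}" "k \<in> {..<m}" "i \<noteq> k"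
    then show "negligible (T i \<inter> T k)"
      using *[of i k] *[of k i] by (cases "i < k") (auto simp: Int_commute)
  qed
  then have volA: "vol A = (\<Sum>j<m. vol (T j))"
    unfolding A_def by (intro measure_negligible_finite_Union_image Tm) auto
  have "A \<inter> uminus ` A \<subseteq> {z. cross (x 0) z = 0}"
  proof -
    have "A \<subseteq> {z. 0 \<le> cross (x 0) z}"
      unfolding A_def T_def by (intro UN_least triangle0_halfplane nn) auto
    then have A0: "0 \<le> cross (x 0) z" if "z \<in> A" for z using that by blast
    show ?thesis
    proof
      fix z assume "z \<in> A \<inter> uminus ` A"
      then show "z \<in> {z. cross (x 0) z = 0}" using A0[of z] A0[of "- z"] by auto
    qed
  qed
  then have "negligible (A \<inter> uminus ` A)"
    using negligible_subset negligible_line support_seq_nonzero[OF K x, of 0] by blast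
  then have 0: "vol (A \<inter> uminus ` A) = 0" by (rule negligible_imp_measure0)
  have um: "uminus ` A = (\<lambda>z. (-1) *\<^sub>R z + 0) ` A" by simp
  have Am': "uminus ` A \<in> lmeasurable"
    by (intro measurable_linear_image Am) (simp add: linear_iff)
  have "2 * vol A = vol A + vol (uminus ` A)"
    unfolding um measure_lebesgue_affine by simp
  also have "\<dots> = vol (A \<union> uminus ` A)"
    using 0 Am Am' by (simp add: measure_Un3)
  also have "\<dots> \<le> vol K"
  proof (rule measure_mono_fmeasurable)
    show "A \<union> uminus ` A \<subseteq> K" using TK sym_body_uminus[OF K] by (auto simp: A_def)
    show "A \<union> uminus ` A \<in> sets lebesgue" using Am Am' by auto
    show "K \<in> lmeasurable" using sym_body_compact[OF K] by (rule lmeasurable_compact)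
  qed
  also have "2 * vol A = (\<Sum>j<m. cross (x j) (x (Suc j)))"
    unfolding volA sum_distrib_left
    by (intro sum.cong) (auto simp: T_def vol_triangle0 nn)
  finally show ?thesis .
qed

text \<open>
  The dilation is written as an affine map with zero translation to match
  measure_lebesgue_affine.
\<close>

lemma in_scaled_triangle0:
  assumes "z = a *\<^sub>R p + b *\<^sub>R q" "0 \<le> a" "0 \<le> b" "a + b \<le> c" "0 < c"
  shows "z \<in> (\<lambda>z. c *\<^sub>R z + 0) ` triangle0 p q"
proof -
  have "(a / c) *\<^sub>R p + (b / c) *\<^sub>R q \<in> triangle0 p q"
    unfolding convex_hull_3
    using assms by (intro CollectI exI[of _ "1 - (a + b) / c"] exI[of _ "a / c"] exI[of _ "b / c"])
      (auto simp: field_simps)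
  moreover have "z = c *\<^sub>R ((a / c) *\<^sub>R p + (b / c) *\<^sub>R q) + 0"
    using assms by (simp add: scaleR_add_right)
  ultimately show ?thesis by (rule rev_image_eqI)
qed

text \<open>
  Every point z of K on the positive side of the line through x 0 lies in the sector between
  two consecutive support points, where cross (x j) z changes sign. Write z = a x j + b x (j + 1). The
  inner product with the direction u j is nearly the support value at both vertices and at most the
  support value at z; hence a + b is at most a constant c close to 1, and z lies in the dilate by c of the
  triangle with vertices 0, x j, x (j + 1). Reflection in the origin deals with the other side.
\<close>

lemma vol_le_sum_cross:
  assumes K: "sym_body K" and x: "support_seq K m x" and m: "0 < m"
    and r: "0 < r" "cball 0 r \<subseteq> K" and R: "\<And>x. x \<in> K \<Longrightarrow> norm x \<le> R"
    and small: "2 * (pi / m) * R < r"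
  shows "vol K \<le> (1 / (1 - 2 * (pi / m) * R / r))\<^sup>2 * (\<Sum>j<m. cross (x j) (x (Suc j)))"
proof -
  define \<alpha> where "\<alpha> = pi / m"
  define u where "u j = dir (j * \<alpha>)" for j :: nat
  define c where "c = 1 / (1 - 2 * \<alpha> * R / r)"
  define T where "T j = triangle0 (x j) (x (Suc j))" for j
  have "2 * \<alpha> * R / r < 1" using small r by (simp add: \<alpha>_def divide_less_eq del: times_divide_eq_left times_divide_eq_right)
  then have c: "0 < c" by (simp add: c_def)
  have sp: "support_point K (u j) (x j)" if "j \<le> m" for j
    using x that by (simp add: support_seq_def u_def \<alpha>_def)
  have uu: "norm (u j - u (Suc j)) \<le> \<alpha>" for j
  proof -
    have "\<bar>real j * \<alpha> - real (Suc j) * \<alpha>\<bar> = \<alpha>" by (simp add: algebra_simps) (simp add: \<alpha>_def)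
    then show ?thesis using dir_diff_le[of "j * \<alpha>" "Suc j * \<alpha>"] by (simp add: u_def)
  qed
  have hr: "r \<le> support_fun K (u j)" for j
    using r by (intro support_fun_lower sym_body_compact[OF K]) (auto simp: u_def)
  have R0: "0 \<le> R" using R sp[of 0] by (metis le0 norm_ge_zero order_trans support_point_def)
  have cover: "\<exists>j<m. z \<in> (\<lambda>z. c *\<^sub>R z + 0) ` T j" if z: "z \<in> K" "0 < cross (x 0) z" for z
  proof -
    have "cross (x m) z \<le> 0" using x z by (simp add: support_seq_def)
    then have ex: "\<exists>k. k \<le> m \<and> cross (x k) z \<le> 0" by blast
    define k where "k = (LEAST k. k \<le> m \<and> cross (x k) z \<le> 0)"
    have k: "k \<le> m" "cross (x k) z \<le> 0" using LeastI_ex[OF ex] by (auto simp: k_def)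
    have "k \<noteq> 0" using k z by (auto intro: ccontr)
    then obtain j where j: "k = Suc j" by (cases k) auto
    have jm: "j < m" using k j by simp
    have pos: "0 < cross (x j) z"
      using not_less_Least[of j "\<lambda>k. k \<le> m \<and> cross (x k) z \<le> 0"] j jm
      by (simp add: k_def[symmetric])
    have neg: "0 \<le> cross z (x (Suc j))" using k j cross_commute[of z] by simp
    define D where "D = cross (x j) (x (Suc j))"
    have xK: "x j \<in> K" "x (Suc j) \<in> K" using sp jm by (auto simp: support_point_def)
    have a1: "u j \<bullet> x (Suc j) \<le> u j \<bullet> x j" "u (Suc j) \<bullet> x j \<le> u (Suc j) \<bullet> x (Suc j)"
      using sp[of j] sp[of "Suc j"] jm by (auto simp: support_point_def)
    have h: "support_fun K (u j) = u j \<bullet> x j" "support_fun K (u (Suc j)) = u (Suc j) \<bullet> x (Suc j)"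
      using sp jm by (auto intro!: support_fun_eq)
    have lip: "support_fun K (u j) \<le> support_fun K (u (Suc j)) + R * \<alpha>"
      using support_fun_Lipschitz[OF sym_body_compact[OF K] sym_body_nonempty[OF K] R, of "u j" "u (Suc j)"]
        mult_left_mono[OF uu R0, of j] by linarith
    have "(u (Suc j) - u j) \<bullet> x (Suc j) \<le> norm (u (Suc j) - u j) * norm (x (Suc j))"
      by (rule norm_cauchy_schwarz)
    also have "\<dots> \<le> \<alpha> * R"
      using uu[of j] R[OF xK(2)] by (intro mult_mono) (auto simp: norm_minus_commute \<alpha>_def)
    finally have low: "support_fun K (u j) - 2 * \<alpha> * R \<le> u j \<bullet> x (Suc j)"
      using lip h by (simp add: inner_diff_left algebra_simps)
    have D0: "0 \<le> D" using support_seq_cross_nonneg[OF K x, of j "Suc j"] jm by (simp add: D_def)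
    \<comment> \<open>If the two vertices were parallel, equality in Lagrange's identity would force them to coincide,\<close>
    \<comment> \<open>and then cross (x j) z could not change sign between them.\<close>
    have "D \<noteq> 0"
    proof
      assume "D = 0"
      then have L: "(u j \<bullet> x j) * (u (Suc j) \<bullet> x (Suc j)) = (u j \<bullet> x (Suc j)) * (u (Suc j) \<bullet> x j)"
        using cross_Lagrange[of "u j" "u (Suc j)" "x j" "x (Suc j)"] by (simp add: D_def)
      have pos1: "0 < u j \<bullet> x (Suc j)" "0 < u (Suc j) \<bullet> x (Suc j)"
        using low hr[of j] hr[of "Suc j"] h small r by (auto simp: \<alpha>_def)
      have e1: "u j \<bullet> x j = u j \<bullet> x (Suc j)"
      proof (rule antisym)
        have "(u j \<bullet> x j) * (u (Suc j) \<bullet> x (Suc j)) \<le> (u j \<bullet> x (Suc j)) * (u (Suc j) \<bullet> x (Suc j))"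
          unfolding L using a1 pos1 by (intro mult_left_mono) auto
        then show "u j \<bullet> x j \<le> u j \<bullet> x (Suc j)" using pos1 by simp
      qed (rule a1)
      then have e2: "u (Suc j) \<bullet> x j = u (Suc j) \<bullet> x (Suc j)" using L pos1 by simp
      have al: "0 < sin \<alpha>"
      proof (rule sin_gt_zero)
        have "\<alpha> * (2 * R) < r" using small by (simp add: \<alpha>_def mult_ac)
        moreover have "r \<le> R" using hr[of j] h R[OF xK(1)] norm_cauchy_schwarz[of "u j" "x j"]
          by (simp add: u_def)
        ultimately have "\<alpha> * (2 * R) < 1 * R" by simp
        then have "\<alpha> * 2 < 1" using R0 r \<open>r \<le> R\<close> by (metis mult.assoc mult_less_cancel_right linorder_not_less)
        then show "\<alpha> < pi" using pi_gt3 by linarith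
        show "0 < \<alpha>" using m by (simp add: \<alpha>_def)
      qed
      have "cross (u j) (u (Suc j)) = sin \<alpha>"
        by (simp add: u_def cross_dir algebra_simps)
      moreover have "(cross (u j) (u (Suc j)))\<^sup>2 * ((x j - x (Suc j)) \<bullet> (x j - x (Suc j))) =
          (u j \<bullet> (x j - x (Suc j)))\<^sup>2 * (u (Suc j) \<bullet> u (Suc j))
          - 2 * (u j \<bullet> (x j - x (Suc j))) * (u (Suc j) \<bullet> (x j - x (Suc j))) * (u j \<bullet> u (Suc j))
          + (u (Suc j) \<bullet> (x j - x (Suc j)))\<^sup>2 * (u j \<bullet> u j)"
        by (simp add: coords power2_eq_square) algebra
      ultimately have "(sin \<alpha>)\<^sup>2 * ((x j - x (Suc j)) \<bullet> (x j - x (Suc j))) = 0"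
        using e1 e2 by (simp add: inner_diff_right)
      then have "x j = x (Suc j)" using al by simp
      then show False using pos neg by (metis cross_commute neg_0_le_iff_le linorder_not_less)
    qed
    with D0 have D: "0 < D" by simp
    define a b where "a = cross z (x (Suc j)) / D" and "b = cross (x j) z / D"
    have zab: "z = a *\<^sub>R x j + b *\<^sub>R x (Suc j)"
      using cross_basis_expansion[of "x j" "x (Suc j)" z] D by (simp add: a_def b_def D_def)
    have ab: "0 \<le> a" "0 \<le> b" using D pos neg by (auto simp: a_def b_def)
    define h0 where "h0 = support_fun K (u j)"
    have h0: "r \<le> h0" "0 < h0" using hr[of j] r by (auto simp: h0_def)
    have "h0 * (1 - 2 * \<alpha> * R / r) \<le> h0 - 2 * \<alpha> * R"
    proof -
      have "2 * \<alpha> * R * 1 \<le> 2 * \<alpha> * R * (h0 / r)"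
        using R0 m h0 r by (intro mult_left_mono) (auto simp: \<alpha>_def)
      then show ?thesis by (simp add: algebra_simps)
    qed
    then have low': "h0 * (1 - 2 * \<alpha> * R / r) \<le> u j \<bullet> x (Suc j)" using low by (simp add: h0_def)
    have "h0 * (1 - 2 * \<alpha> * R / r) \<le> h0 * 1"
      using h0 R0 m r by (intro mult_left_mono) (auto simp: \<alpha>_def)
    then have "a * (h0 * (1 - 2 * \<alpha> * R / r)) + b * (h0 * (1 - 2 * \<alpha> * R / r)) \<le> a * h0 + b * (u j \<bullet> x (Suc j))"
      using ab low' by (intro add_mono mult_left_mono) auto
    also have "\<dots> = u j \<bullet> z" by (simp add: zab inner_add_right h0_def h)
    also have "\<dots> \<le> h0" unfolding h0_def by (rule inner_le_support_fun[OF sym_body_compact[OF K] z(1)])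
    finally have "h0 * ((a + b) * (1 - 2 * \<alpha> * R / r)) \<le> h0 * 1" by (simp add: algebra_simps add_divide_distrib)
    then have "(a + b) * (1 - 2 * \<alpha> * R / r) \<le> 1" using h0 by (simp only: mult_le_cancel_left_pos)
    then have "a + b \<le> c" using c by (simp add: c_def field_simps)
    then show ?thesis using jm in_scaled_triangle0[OF zab ab _ c] by (auto simp: T_def)
  qed
  define A where "A = (\<Union>j<m. (\<lambda>z. c *\<^sub>R z + 0) ` T j)"
  have Tm: "(\<lambda>z. c *\<^sub>R z + 0) ` T j \<in> lmeasurable" for j
    unfolding T_def by (intro lmeasurable_compact compact_continuous_image continuous_intros triangle0_compact)
  have Am: "A \<in> lmeasurable" using Tm by (auto simp: A_def)
  have um: "uminus ` A = (\<lambda>z. (-1) *\<^sub>R z + 0) ` A" by simp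
  have Am': "uminus ` A \<in> lmeasurable"
    by (intro measurable_linear_image Am) (simp add: linear_iff)
  define N where "N = {z. cross (x 0) z = 0}"
  have N: "negligible N" unfolding N_def by (rule negligible_line[OF support_seq_nonzero[OF K x]]) simp
  have Ns: "N \<in> sets lebesgue" and N0: "vol N = 0"
    using N by (auto intro: negligible_imp_sets negligible_imp_measure0)
  have KA: "K \<subseteq> N \<union> (A \<union> uminus ` A)"
  proof
    fix z assume z: "z \<in> K"
    consider "cross (x 0) z = 0" | "0 < cross (x 0) z" | "0 < cross (x 0) (- z)" by fastforce
    then show "z \<in> N \<union> (A \<union> uminus ` A)"
    proof cases
      case 2
      then show ?thesis using cover[OF z] by (auto simp: A_def)
    next
      case 3
      then have "- z \<in> A" using cover[OF sym_body_uminus[OF K z]] by (auto simp: A_def)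
      then show ?thesis by force
    qed (simp add: N_def)
  qed
  have Nf: "N \<in> lmeasurable" using N by (simp add: negligible_imp_measurable)
  have "vol K \<le> vol (N \<union> (A \<union> uminus ` A))"
    by (rule measure_mono_fmeasurable[OF KA])
       (use Nf Am Am' sym_body_compact[OF K] lmeasurable_compact in auto)
  also have "\<dots> \<le> vol N + (vol A + vol (uminus ` A))"
    using Ns Am Am' by (intro order_trans[OF measure_Un_le] add_left_mono measure_Un_le) auto
  also have "\<dots> = 2 * vol A"
    unfolding um measure_lebesgue_affine by (simp add: N0)
  also have "vol A \<le> (\<Sum>j<m. vol ((\<lambda>z. c *\<^sub>R z + 0) ` T j))"
    unfolding A_def using Tm by (intro measure_UNION_le) auto
  also have "\<dots> = (\<Sum>j<m. c\<^sup>2 * (cross (x j) (x (Suc j)) / 2))"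
    unfolding measure_lebesgue_affine
    using support_seq_cross_nonneg[OF K x] by (intro sum.cong) (auto simp: T_def vol_triangle0)
  also have "\<dots> = c\<^sup>2 / 2 * (\<Sum>j<m. cross (x j) (x (Suc j)))"
    by (simp add: sum_distrib_left)
  finally show ?thesis by (simp add: c_def \<alpha>_def)
qed

lemma sum_cross_tendsto_vol:
  assumes K: "sym_body K" and x: "\<And>m. 0 < m \<Longrightarrow> support_seq K m (x m)"
  shows "(\<lambda>m. \<Sum>j<m. cross (x m j) (x m (Suc j))) \<longlonglongrightarrow> vol K"
proof -
  obtain r R where r: "0 < r" "cball 0 r \<subseteq> K" and R: "\<And>x. x \<in> K \<Longrightarrow> norm x \<le> R"
    using sym_body_radii[OF K] by metis
  define q where "q m = 1 - 2 * (pi / real m) * R / r" for m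
  have q1: "q \<longlonglongrightarrow> 1"
  proof -
    have "(\<lambda>m. 1 - (2 * pi * R / r) * inverse (real m)) \<longlonglongrightarrow> 1 - (2 * pi * R / r) * 0"
      by (intro tendsto_intros lim_inverse_n)
    moreover have "(\<lambda>m. 1 - (2 * pi * R / r) * inverse (real m)) = q"
      by (auto simp: q_def fun_eq_iff field_simps)
    ultimately show ?thesis by simp
  qed
  show ?thesis
  proof (rule tendsto_sandwich)
    show "\<forall>\<^sub>F m in sequentially. (q m)\<^sup>2 * vol K \<le> (\<Sum>j<m. cross (x m j) (x m (Suc j)))"
      using eventually_gt_at_top[of 0] order_tendstoD(1)[OF q1, of 0, simplified]
    proof eventually_elim
      case (elim m)
      have "2 * (pi / m) * R < r"
        using elim(2) r(1) by (simp add: q_def divide_less_eq del: times_divide_eq_left times_divide_eq_right)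
      then have "vol K \<le> (1 / q m)\<^sup>2 * (\<Sum>j<m. cross (x m j) (x m (Suc j)))"
        unfolding q_def using elim by (intro vol_le_sum_cross[OF K x _ r R]) auto
      then have "(q m)\<^sup>2 * vol K \<le> (q m)\<^sup>2 * ((1 / q m)\<^sup>2 * (\<Sum>j<m. cross (x m j) (x m (Suc j))))"
        by (rule mult_left_mono) simp
      also have "\<dots> = (\<Sum>j<m. cross (x m j) (x m (Suc j)))"
        using elim(2) by (simp add: power_divide)
      finally show ?case .
    qed
    show "\<forall>\<^sub>F m in sequentially. (\<Sum>j<m. cross (x m j) (x m (Suc j))) \<le> vol K"
      using eventually_gt_at_top[of 0] by eventually_elim (intro sum_cross_le_vol[OF K x])
    have "(\<lambda>m. (q m)\<^sup>2 * vol K) \<longlonglongrightarrow> 1\<^sup>2 * vol K" by (intro tendsto_intros q1)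
    then show "(\<lambda>m. (q m)\<^sup>2 * vol K) \<longlonglongrightarrow> vol K" by simp
  qed simp
qed

section \<open>The mixed area\<close>

text \<open>
  Among the support points in a direction u, the first one in the counterclockwise sense. The
  choice is unique, hence compatible with reflection in the origin, and it makes the points with normal
  in a half-open arc of directions lie between the two support points at the ends of the arc.
\<close>

definition start_point :: "(real^2) set \<Rightarrow> real^2 \<Rightarrow> real^2 \<Rightarrow> bool" where
  "start_point K u x \<longleftrightarrow>
     support_point K u x \<and> (\<forall>y. support_point K u y \<longrightarrow> perp u \<bullet> x \<le> perp u \<bullet> y)"

lemma start_point_exists:
  assumes K: "compact K" "K \<noteq> {}"
  obtains x where "start_point K u x"
proof -
  define F where "F = K \<inter> {x. u \<bullet> x = support_fun K u}"
  have F: "x \<in> F \<longleftrightarrow> support_point K u x" for x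
    using inner_le_support_fun[OF K(1), of _ u] support_fun_eq[of K u x]
    by (auto simp: F_def support_point_def)
  have "compact F" unfolding F_def
    by (intro compact_Int_closed K closed_hyperplane)
  moreover obtain x0 where "support_point K u x0" using support_point_exists[OF K] .
  then have "F \<noteq> {}" using F by blast
  moreover have "continuous_on F (\<lambda>y. perp u \<bullet> y)" by (intro continuous_intros)
  ultimately obtain x where "x \<in> F" "\<forall>y\<in>F. perp u \<bullet> x \<le> perp u \<bullet> y"
    using continuous_attains_inf by blast
  then show ?thesis using that F by (auto simp: start_point_def)
qed

lemma start_point_unique:
  assumes "u \<noteq> 0" "start_point K u x" "start_point K u y"
  shows "x = y"
  using assms by (intro inner_perp_eqI[of u]) (auto simp: start_point_def support_point_def intro: antisym)

lemma start_point_uminus: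
  assumes K: "sym_body K" and x: "start_point K u x"
  shows "start_point K (- u) (- x)"
  using x support_point_uminus[OF K, of u x] support_point_uminus[OF K, of "- u"]
  unfolding start_point_def by force

definition start_of :: "(real^2) set \<Rightarrow> real^2 \<Rightarrow> real^2" where
  "start_of K u = (SOME x. start_point K u x)"

lemma start_of: "sym_body K \<Longrightarrow> start_point K u (start_of K u)"
  unfolding start_of_def
  by (rule someI_ex, rule start_point_exists[OF sym_body_compact sym_body_nonempty, of K u]) auto

lemma start_of_uminus: "sym_body K \<Longrightarrow> u \<noteq> 0 \<Longrightarrow> start_of K (- u) = - start_of K u"
  by (rule start_point_unique[of "- u" K]) (auto intro: start_of start_point_uminus)

definition grid_point :: "(real^2) set \<Rightarrow> nat \<Rightarrow> nat \<Rightarrow> real^2" where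
  "grid_point K m j = start_of K (dir (j * (pi / m)))"

lemma grid_point_shift:
  assumes K: "sym_body K" and m: "0 < m"
  shows "grid_point K m (j + m) = - grid_point K m j"
proof -
  have "dir (real (j + m) * (pi / m)) = - dir (j * (pi / m))"
  proof -
    have "real (j + m) * (pi / m) = j * (pi / m) + pi" using m by (simp add: field_simps)
    then show ?thesis by (simp only: dir_add_pi)
  qed
  then show ?thesis by (simp add: grid_point_def start_of_uminus[OF K])
qed

lemma support_seq_grid_point:
  assumes "sym_body K" "0 < m"
  shows "support_seq K m (grid_point K m)"
  using grid_point_shift[OF assms, of 0] start_of[OF assms(1)] assms
  by (auto simp: support_seq_def grid_point_def start_point_def)

abbreviation msum :: "'a::euclidean_space set \<Rightarrow> real \<Rightarrow> 'a set \<Rightarrow> 'a set" where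
  "msum K t L \<equiv> {x + t *\<^sub>R y |x y. x \<in> K \<and> y \<in> L}"

lemma msum_eq_sums: "msum K t L = {x + y |x y. x \<in> K \<and> y \<in> (*\<^sub>R) t ` L}"
  by auto

lemma sym_body_msum:
  assumes K: "sym_body K" and L: "sym_body L"
  shows "sym_body (msum K t L)"
proof -
  have "compact (msum K t L)"
    unfolding msum_eq_sums
    by (intro compact_sums compact_scaling sym_body_compact K L)
  moreover have "convex (\<Union>x\<in>K. \<Union>y\<in>(*\<^sub>R) t ` L. {x + y})"
    by (intro convex_sums convex_scaling sym_body_convex K L)
  then have "convex (msum K t L)"
    by (rule back_subst[of convex]) auto
  moreover have "K \<subseteq> msum K t L"
  proof
    fix x assume "x \<in> K"
    moreover have "0 \<in> L" using sym_body_zero_interior[OF L] interior_subset by blast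
    ultimately have "x + t *\<^sub>R 0 \<in> msum K t L" by blast
    then show "x \<in> msum K t L" by simp
  qed
  then have "interior (msum K t L) \<noteq> {}"
    using sym_body_interior[OF K] interior_mono by blast
  moreover have "uminus ` msum K t L = msum K t L"
  proof -
    have neg: "- z \<in> msum K t L" if z: "z \<in> msum K t L" for z
    proof -
      obtain x y where "x \<in> K" "y \<in> L" "z = x + t *\<^sub>R y" using z by blast
      then have "- x \<in> K" "- y \<in> L" "- z = - x + t *\<^sub>R (- y)"
        using sym_body_uminus[OF K] sym_body_uminus[OF L] by auto
      then show ?thesis by blast
    qed
    show ?thesis
    proof
      show "uminus ` msum K t L \<subseteq> msum K t L" using neg by blast
      show "msum K t L \<subseteq> uminus ` msum K t L" using neg by (metis (no_types, lifting) image_eqI minus_minus subsetI)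
    qed
  qed
  ultimately show ?thesis
    by (simp add: sym_body_def convex_body_def centrally_symmetric_def)
qed

lemma support_seq_msum:
  assumes x: "support_seq K m x" and y: "support_seq L m y" and t: "0 \<le> t"
  shows "support_seq (msum K t L) m (\<lambda>j. x j + t *\<^sub>R y j)"
  unfolding support_seq_def
proof (intro conjI allI impI)
  show "x m + t *\<^sub>R y m = - (x 0 + t *\<^sub>R y 0)" using x y by (simp add: support_seq_def)
  fix j assume "j \<le> m"
  then have "support_point K (dir (j * (pi / m))) (x j)" "support_point L (dir (j * (pi / m))) (y j)"
    using x y by (auto simp: support_seq_def)
  then show "support_point (msum K t L) (dir (j * (pi / m))) (x j + t *\<^sub>R y j)"
    using t by (auto simp: support_point_def inner_add_right intro!: add_mono mult_left_mono)
qed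

text \<open>
  The coefficient of t in the shoelace sum of the points x j + t y j, where x j and y j are the
  support points of K and L.
\<close>

definition grid_mixed :: "(real^2) set \<Rightarrow> (real^2) set \<Rightarrow> nat \<Rightarrow> real" where
  "grid_mixed K L m = (\<Sum>j<m. cross (grid_point K m j) (grid_point L m (Suc j))
     + cross (grid_point L m j) (grid_point K m (Suc j)))"

text \<open>
  The support points of K + t L are sums of support points, so its shoelace sums are quadratic
  polynomials in t. The outer coefficients converge to the areas of K and of L and the values at t = 1
  converge, hence so does the middle coefficient.
\<close>

lemma
  assumes K: "sym_body K" and L: "sym_body L"
  shows grid_mixed_tendsto: "grid_mixed K L \<longlonglongrightarrow> 2 * mixed_area L K"
    and vol_msum: "0 \<le> t \<Longrightarrow> vol (msum K t L) = vol K + 2 * t * mixed_area L K + t\<^sup>2 * vol L"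
proof -
  define S where "S M m = (\<Sum>j<m. cross (grid_point M m j) (grid_point M m (Suc j)))" for M m
  have lim: "(\<lambda>m. S K m + t * grid_mixed K L m + t\<^sup>2 * S L m) \<longlonglongrightarrow> vol (msum K t L)"
    if "0 \<le> t" for t
  proof -
    have "(\<lambda>m. \<Sum>j<m. cross (grid_point K m j + t *\<^sub>R grid_point L m j)
            (grid_point K m (Suc j) + t *\<^sub>R grid_point L m (Suc j))) \<longlonglongrightarrow> vol (msum K t L)"
      using that by (intro sum_cross_tendsto_vol sym_body_msum K L support_seq_msum support_seq_grid_point)
    also have "(\<lambda>m. \<Sum>j<m. cross (grid_point K m j + t *\<^sub>R grid_point L m j)
            (grid_point K m (Suc j) + t *\<^sub>R grid_point L m (Suc j))) =
          (\<lambda>m. S K m + t * grid_mixed K L m + t\<^sup>2 * S L m)"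
    proof
      fix m
      have "cross (a + t *\<^sub>R c) (b + t *\<^sub>R d) = cross a b + t * (cross a d + cross c b) + t\<^sup>2 * cross c d" for a b c d
        by (simp add: coords power2_eq_square algebra_simps)
      then show "(\<Sum>j<m. cross (grid_point K m j + t *\<^sub>R grid_point L m j)
            (grid_point K m (Suc j) + t *\<^sub>R grid_point L m (Suc j))) = S K m + t * grid_mixed K L m + t\<^sup>2 * S L m"
        by (simp add: S_def grid_mixed_def sum.distrib flip: sum_distrib_left)
    qed
    finally show ?thesis .
  qed
  have SK: "S K \<longlonglongrightarrow> vol K" and SL: "S L \<longlonglongrightarrow> vol L"
    unfolding S_def by (intro sum_cross_tendsto_vol K L support_seq_grid_point; simp)+
  define W where "W = vol (msum K 1 L) - vol K - vol L"
  have "(\<lambda>m. (S K m + 1 * grid_mixed K L m + 1\<^sup>2 * S L m) - S K m - S L m) \<longlonglongrightarrow> W"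
    unfolding W_def by (intro tendsto_diff lim SK SL) simp
  then have W: "grid_mixed K L \<longlonglongrightarrow> W" by simp
  have quad: "vol (msum K t L) = vol K + 2 * t * (W / 2) + t\<^sup>2 * vol L" if "0 \<le> t" for t
  proof -
    have "(\<lambda>m. S K m + t * grid_mixed K L m + t\<^sup>2 * S L m) \<longlonglongrightarrow> vol K + t * W + t\<^sup>2 * vol L"
      by (intro tendsto_intros SK SL W)
    from LIMSEQ_unique[OF lim[OF that] this] show ?thesis by simp
  qed
  have mixed: "mixed_area L K = W / 2"
    unfolding mixed_area_def
  proof (rule the_equality)
    show "\<forall>t\<ge>0. vol (msum K t L) = vol K + 2 * t * (W / 2) + t\<^sup>2 * vol L" using quad by blast
    fix v assume "\<forall>t\<ge>0. vol (msum K t L) = vol K + 2 * t * v + t\<^sup>2 * vol L"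
    then have "vol (msum K 1 L) = vol K + 2 * 1 * v + 1\<^sup>2 * vol L" using zero_le_one by blast
    then show "v = W / 2" by (simp add: W_def)
  qed
  show "grid_mixed K L \<longlonglongrightarrow> 2 * mixed_area L K" using W by (simp add: mixed)
  show "vol (msum K t L) = vol K + 2 * t * mixed_area L K + t\<^sup>2 * vol L" if "0 \<le> t"
    using quad[OF that] by (simp add: mixed)
qed

lemma inner_image_sym_body:
  assumes K: "sym_body K"
  shows "(\<lambda>x. u \<bullet> x) ` K = {- support_fun K u..support_fun K u}"
proof
  show "(\<lambda>x. u \<bullet> x) ` K \<subseteq> {- support_fun K u..support_fun K u}"
    using abs_inner_le_support_fun[OF K, of _ u] by (force simp: abs_le_iff)
  obtain x where x: "support_point K u x"
    using support_point_exists sym_body_compact[OF K] sym_body_nonempty[OF K] by blast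
  have "- x \<in> K" "x \<in> K" using x sym_body_uminus[OF K] by (auto simp: support_point_def)
  then have "u \<bullet> (- x) \<in> (\<lambda>x. u \<bullet> x) ` K" "u \<bullet> x \<in> (\<lambda>x. u \<bullet> x) ` K" by blast+
  moreover have "connected ((\<lambda>x. u \<bullet> x) ` K)"
    by (intro connected_continuous_image continuous_intros convex_connected sym_body_convex[OF K])
  ultimately have "{u \<bullet> (- x)..u \<bullet> x} \<subseteq> (\<lambda>x. u \<bullet> x) ` K"
    using connected_contains_Icc by blast
  then show "{- support_fun K u..support_fun K u} \<subseteq> (\<lambda>x. u \<bullet> x) ` K"
    by (simp add: support_fun_eq[OF x])
qed

lemma support_fun_pos: "sym_body K \<Longrightarrow> norm u = 1 \<Longrightarrow> 0 < support_fun K u"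
  using sym_body_radii[of K] support_fun_lower[OF sym_body_compact, of K _ u]
  by (metis less_eq_real_def less_le_trans)

text \<open>
  The dilate of L by a / b has the same width as K in the direction u. Expanding the area of its
  sum with K gives the claim.
\<close>

lemma Bonnesen_symmetric:
  assumes K: "sym_body K" and L: "sym_body L" and u: "norm u = 1"
    and a: "a = support_fun K u" and b: "b = support_fun L u"
  shows "a\<^sup>2 * vol L + b\<^sup>2 * vol K \<le> 2 * a * b * mixed_area L K"
proof -
  have ab: "0 < a" "0 < b" unfolding a b by (intro support_fun_pos K L u)+
  define s where "s = a / b"
  have s: "0 < s" using ab by (simp add: s_def)
  have "(\<lambda>x. u \<bullet> x) ` ((*\<^sub>R) s ` L) = (*) s ` ((\<lambda>x. u \<bullet> x) ` L)"
    by (auto simp: image_image)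
  also have "\<dots> = (\<lambda>x. u \<bullet> x) ` K"
    unfolding inner_image_sym_body[OF K] inner_image_sym_body[OF L] a[symmetric] b[symmetric]
    using image_mult_atLeastAtMost[OF s, of "- b" b] ab by (simp add: s_def)
  finally have "2 * vol K + 2 * vol ((*\<^sub>R) s ` L) \<le> vol (msum K s L)"
    unfolding msum_eq_sums using K L u
    by (intro vol_sum_equal_width) (auto intro: sym_body_compact sym_body_convex compact_scaling convex_scaling)
  then have "vol K + s\<^sup>2 * vol L \<le> 2 * s * mixed_area L K"
    using vol_msum[OF K L, of s] s by (simp add: vol_scale mult.commute)
  then have "b\<^sup>2 * (vol K + s\<^sup>2 * vol L) \<le> b\<^sup>2 * (2 * s * mixed_area L K)"
    by (rule mult_left_mono) simp
  moreover have "b\<^sup>2 * (vol K + s\<^sup>2 * vol L) = a\<^sup>2 * vol L + b\<^sup>2 * vol K"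
    "b\<^sup>2 * (2 * s * mixed_area L K) = 2 * a * b * mixed_area L K"
    using ab by (simp_all add: s_def power2_eq_square field_simps)
  ultimately show ?thesis by simp
qed

lemma mixed_area_nonneg:
  assumes K: "sym_body K" and L: "sym_body L"
  shows "0 \<le> mixed_area L K"
proof -
  define u where "u = dir 0"
  have pos: "0 < support_fun K u * support_fun L u"
    by (intro mult_pos_pos support_fun_pos K L) (simp_all add: u_def)
  have "0 \<le> (support_fun K u)\<^sup>2 * vol L + (support_fun L u)\<^sup>2 * vol K" by simp
  also have "\<dots> \<le> 2 * support_fun K u * support_fun L u * mixed_area L K"
    by (rule Bonnesen_symmetric[OF K L]) (simp_all add: u_def)
  finally have "0 \<le> (2 * (support_fun K u * support_fun L u)) * mixed_area L K" by (simp add: mult.assoc)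
  then show ?thesis using pos by (subst (asm) zero_le_mult_iff) linarith
qed

text \<open>
  The left-hand side of Bonnesen's inequality is at least twice the geometric mean of its two
  terms.
\<close>

lemma Minkowski_inequality_symmetric:
  assumes K: "sym_body K" and L: "sym_body L"
  shows "vol K * vol L \<le> (mixed_area L K)\<^sup>2"
proof -
  define a b where "a = support_fun K (dir 0)" and "b = support_fun L (dir 0)"
  have ab: "0 < a" "0 < b" unfolding a_def b_def by (intro support_fun_pos K L; simp)+
  have "a\<^sup>2 * vol L + b\<^sup>2 * vol K \<le> 2 * a * b * mixed_area L K"
    by (rule Bonnesen_symmetric[OF K L]) (simp_all add: a_def b_def)
  then have "(a\<^sup>2 * vol L + b\<^sup>2 * vol K)\<^sup>2 \<le> (2 * a * b * mixed_area L K)\<^sup>2"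
    by (rule power_mono) simp
  moreover have "0 \<le> (a\<^sup>2 * vol L - b\<^sup>2 * vol K)\<^sup>2" by simp
  ultimately have "(4 * a\<^sup>2 * b\<^sup>2) * (vol K * vol L) \<le> (4 * a\<^sup>2 * b\<^sup>2) * (mixed_area L K)\<^sup>2"
    by (simp add: power2_eq_square algebra_simps)
  then show ?thesis using ab by simp
qed

text \<open>
  Summation by parts. The boundary terms cancel because x m = - x 0 and y m = - y 0. In this form
  each edge of the polygon inscribed in K is multiplied by support points of L, which makes the sum
  comparable with the integral of the support function of L over the boundary of K.
\<close>

lemma grid_mixed_eq:
  assumes K: "sym_body K" and L: "sym_body L" and m: "0 < m"
  shows "grid_mixed K L m = (\<Sum>j<m. cross (grid_point L m j) (grid_point K m (Suc j) - grid_point K m j)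
     + cross (grid_point L m (Suc j)) (grid_point K m (Suc j) - grid_point K m j))"
proof -
  define x y where "x = grid_point K m" and "y = grid_point L m"
  have "(\<Sum>j<m. (cross (x j) (y (Suc j)) + cross (y j) (x (Suc j)))
          - (cross (y j) (x (Suc j) - x j) + cross (y (Suc j)) (x (Suc j) - x j)))
      = (\<Sum>j<m. cross (x (Suc j)) (y (Suc j)) - cross (x j) (y j))"
    by (intro sum.cong) (auto simp: coords algebra_simps)
  also have "\<dots> = cross (x m) (y m) - cross (x 0) (y 0)"
    by (rule sum_lessThan_telescope)
  also have "\<dots> = 0"
    using grid_point_shift[OF K m, of 0] grid_point_shift[OF L m, of 0] by (simp add: x_def y_def)
  finally show ?thesis by (simp add: sum_subtractf grid_mixed_def x_def y_def)
qed

section \<open>Boundary points whose normals lie in a small arc\<close>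

definition gauss_preimage :: "'a::euclidean_space set \<Rightarrow> 'a set \<Rightarrow> 'a set" where
  "gauss_preimage K \<omega> = {x \<in> regular_boundary K. gauss_map K x \<in> \<omega>}"

lemma gauss_map_normal:
  "x \<in> regular_boundary K \<Longrightarrow> outer_unit_normal K x (gauss_map K x)"
  unfolding regular_boundary_def gauss_map_def by (auto intro: theI')

lemma gauss_preimageD:
  assumes "compact K" "x \<in> gauss_preimage K \<omega>"
  shows "x \<in> K" "gauss_map K x \<in> \<omega>" "support_point K (gauss_map K x) x"
proof -
  have x: "x \<in> regular_boundary K" "gauss_map K x \<in> \<omega>"
    using assms by (auto simp: gauss_preimage_def)
  then show "gauss_map K x \<in> \<omega>" by simp
  show "x \<in> K" using x assms(1) compact_imp_closed frontier_subset_closed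
    by (auto simp: regular_boundary_def)
  then show "support_point K (gauss_map K x) x"
    using gauss_map_normal[OF x(1)] by (simp add: outer_unit_normal_def support_point_def)
qed

definition circle_arc :: "real \<Rightarrow> real \<Rightarrow> (real^2) set" where
  "circle_arc a b = dir ` {a..<b}"

lemma arc_decompose:
  assumes w: "w \<in> circle_arc a b" and ab: "b < a + pi"
  obtains p q where "0 < p" "0 \<le> q" "w = p *\<^sub>R dir a + q *\<^sub>R dir b"
proof -
  obtain t where t: "a \<le> t" "t < b" "w = dir t" using w by (auto simp: circle_arc_def)
  have pos: "0 < sin (b - t)" "0 < sin (b - a)" "0 \<le> sin (t - a)"
    using t ab by (auto intro!: sin_gt_zero sin_ge_zero)
  have "cross (dir a) (dir b) \<noteq> 0" using pos by (simp add: cross_dir)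
  from cross_basis_expansion[OF this, of w]
  have "w = (sin (b - t) / sin (b - a)) *\<^sub>R dir a + (sin (t - a) / sin (b - a)) *\<^sub>R dir b"
    by (simp add: cross_dir t(3))
  then show ?thesis using pos by (intro that) auto
qed

lemma arc_norm_diff: "w \<in> circle_arc a b \<Longrightarrow> norm (w - dir a) \<le> b - a"
proof -
  assume "w \<in> circle_arc a b"
  then obtain t where "a \<le> t" "t < b" "w = dir t" by (auto simp: circle_arc_def)
  then show ?thesis using dir_diff_le[of t a] by simp
qed

text \<open>
  A chord e that is not outgoing with respect to one normal between the directions at angles a and
  a + t, and not ingoing with respect to another one, is nearly orthogonal to the direction at angle a.
\<close>

lemma chord_flat:
  assumes t: "0 \<le> t" "t < pi / 2"
    and w: "w = p *\<^sub>R dir a + q *\<^sub>R dir (a + t)" "0 \<le> p" "0 \<le> q" "0 < p + q" "w \<bullet> e \<le> 0"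
    and w': "w' = p' *\<^sub>R dir a + q' *\<^sub>R dir (a + t)" "0 \<le> p'" "0 \<le> q'" "0 < p' + q'" "0 \<le> w' \<bullet> e"
  shows "\<bar>dir a \<bullet> e\<bar> \<le> tan t * \<bar>cross (dir a) e\<bar>"
proof -
  define c s where "c = dir a \<bullet> e" and "s = cross (dir a) e"
  have ct: "0 < cos t" using t by (intro cos_gt_zero_pi) auto
  have st: "0 \<le> sin t" using t by (intro sin_ge_zero) auto
  have tan: "sin t = tan t * cos t" using ct by (simp add: tan_def)
  have tn: "0 \<le> tan t" using st ct by (simp add: tan_def)
  have A: "0 < p + q * cos t" if "0 \<le> p" "0 \<le> q" "0 < p + q" for p q :: real
    using that ct by (cases "p = 0") (auto intro: add_pos_nonneg)
  note A1 = A[OF w(2-4)] and A2 = A[OF w'(2-4)]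
  have e1: "(p + q * cos t) * c + q * sin t * s \<le> 0"
    using w by (simp add: dir_inner_shift inner_add_left c_def s_def algebra_simps)
  have e2: "0 \<le> (p' + q' * cos t) * c + q' * sin t * s"
    using w' by (simp add: dir_inner_shift inner_add_left c_def s_def algebra_simps)
  have B: "q * sin t \<le> tan t * (p + q * cos t)" "q' * sin t \<le> tan t * (p' + q' * cos t)"
    using w(2) w'(2) tn by (auto simp: tan algebra_simps)
  have Bn: "0 \<le> q * sin t" "0 \<le> q' * sin t" using w w' st by auto
  consider "0 \<le> s" | "s \<le> 0" by linarith
  then have "\<bar>c\<bar> \<le> tan t * \<bar>s\<bar>"
  proof cases
    case 1
    have "(p + q * cos t) * c \<le> 0" using e1 mult_nonneg_nonneg[OF Bn(1) 1] by linarith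
    then have c: "c \<le> 0" using A1 by (simp add: mult_le_0_iff)
    have "(p' + q' * cos t) * (- c) \<le> (p' + q' * cos t) * (tan t * s)"
      using e2 mult_right_mono[OF B(2) 1] by (simp add: algebra_simps)
    then have "- c \<le> tan t * s" using A2 by (simp only: mult_le_cancel_left_pos)
    then show ?thesis using c 1 by simp
  next
    case 2
    have "0 \<le> (p' + q' * cos t) * c" using e2 mult_nonneg_nonpos[OF Bn(2) 2] by linarith
    then have c: "0 \<le> c" using A2 by (simp add: zero_le_mult_iff)
    have "q * sin t * (- s) \<le> tan t * (p + q * cos t) * (- s)"
      using B(1) 2 by (intro mult_right_mono) auto
    then have "(p + q * cos t) * c \<le> (p + q * cos t) * (tan t * (- s))"
      using e1 by (simp add: algebra_simps)
    then have "c \<le> tan t * (- s)" using A1 by (simp only: mult_le_cancel_left_pos)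
    then show ?thesis using c 2 by simp
  qed
  then show ?thesis by (simp add: c_def s_def)
qed

lemma gauss_preimage_flat:
  assumes K: "compact K" and t: "0 < t" "t < pi / 2"
    and x: "x \<in> gauss_preimage K (circle_arc a (a + t))" and y: "y \<in> gauss_preimage K (circle_arc a (a + t))"
  shows "\<bar>dir a \<bullet> (y - x)\<bar> \<le> tan t * \<bar>cross (dir a) (y - x)\<bar>"
proof -
  note X = gauss_preimageD[OF K x] and Y = gauss_preimageD[OF K y]
  have ab: "a + t < a + pi" using t by simp
  obtain p q where 1: "0 < p" "0 \<le> q" "gauss_map K x = p *\<^sub>R dir a + q *\<^sub>R dir (a + t)"
    using arc_decompose[OF X(2) ab] .
  obtain p' q' where 2: "0 < p'" "0 \<le> q'" "gauss_map K y = p' *\<^sub>R dir a + q' *\<^sub>R dir (a + t)"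
    using arc_decompose[OF Y(2) ab] .
  show ?thesis
    by (rule chord_flat[OF _ t(2) 1(3) _ 1(2) _ _ 2(3) _ 2(2)])
       (use t 1 2 X Y in \<open>auto simp: support_point_def inner_diff_right\<close>)
qed

lemma gauss_preimage_norm_le:
  assumes K: "compact K" and t: "0 < t" "t < pi / 2"
    and x: "x \<in> gauss_preimage K (circle_arc a (a + t))" and y: "y \<in> gauss_preimage K (circle_arc a (a + t))"
  shows "norm (y - x) \<le> \<bar>cross (dir a) y - cross (dir a) x\<bar> / cos t"
proof -
  have ct: "0 < cos t" using t by (intro cos_gt_zero_pi) auto
  define e where "e = y - x"
  define c s where "c = dir a \<bullet> e" and "s = cross (dir a) e"
  have s: "s = cross (dir a) y - cross (dir a) x" by (simp add: s_def e_def coords algebra_simps)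
  have "\<bar>c\<bar> \<le> tan t * \<bar>s\<bar>" using gauss_preimage_flat[OF K t x y] by (simp add: c_def s_def e_def)
  then have "c\<^sup>2 \<le> (tan t * \<bar>s\<bar>)\<^sup>2" by (metis abs_ge_zero power2_abs power_mono)
  then have "(norm e)\<^sup>2 \<le> (1 + (tan t)\<^sup>2) * s\<^sup>2"
    by (simp add: norm_dir_decompose[of _ a] power_mult_distrib algebra_simps flip: c_def s_def)
  also have "\<dots> = (\<bar>s\<bar> / cos t)\<^sup>2"
    using tan_sec[of t] ct by (simp add: power_divide power_inverse inverse_eq_divide)
  finally have "norm e \<le> \<bar>s\<bar> / cos t" using ct by (auto intro: power2_le_imp_le)
  then show ?thesis by (simp add: s e_def)
qed

text \<open>
  In the degenerate case q = 0 the normal at z is the direction at angle a itself, so that x and z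
  lie on the same face; there the choice of x as the first point of that face is used. At the other end
  the arc is open, so that z never lies beyond y.
\<close>

lemma gauss_preimage_between:
  assumes K: "compact K" and t: "0 < t" "t < pi / 2"
    and x: "start_point K (dir a) x" and y: "start_point K (dir (a + t)) y"
    and z: "z \<in> gauss_preimage K (circle_arc a (a + t))"
  shows "cross (dir a) x \<le> cross (dir a) z" "cross (dir a) z \<le> cross (dir a) y"
proof -
  note Z = gauss_preimageD[OF K z]
  have xK: "x \<in> K" and yK: "y \<in> K" using x y by (auto simp: start_point_def support_point_def)
  have ct: "0 < cos t" and st: "0 < sin t" using t by (auto intro: cos_gt_zero_pi sin_gt_zero)
  obtain p q where pq: "0 < p" "0 \<le> q" "gauss_map K z = p *\<^sub>R dir a + q *\<^sub>R dir (a + t)"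
    using arc_decompose[OF Z(2)] t by auto
  have cross_diff: "cross u (v - w) = cross u v - cross u w" for u v w
    by (simp add: coords algebra_simps)
  show "cross (dir a) x \<le> cross (dir a) z"
  proof (cases "q = 0")
    case True
    have "p * (dir a \<bullet> v) \<le> p * (dir a \<bullet> z)" if "v \<in> K" for v
      using Z(3) that True by (simp add: support_point_def pq)
    then have "support_point K (dir a) z" using pq Z(1) by (simp add: support_point_def)
    then show ?thesis using x by (simp add: start_point_def cross_eq_perp)
  next
    case False
    have c: "dir a \<bullet> (z - x) \<le> 0" using x Z(1) by (simp add: start_point_def support_point_def inner_diff_right)
    have "0 \<le> gauss_map K z \<bullet> (z - x)"
      using Z(3) xK by (simp add: support_point_def inner_diff_right)
    also have "\<dots> = (p + q * cos t) * (dir a \<bullet> (z - x)) + q * sin t * cross (dir a) (z - x)"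
      by (simp add: pq(3) inner_add_left dir_inner_shift) (simp add: distrib_left distrib_right)
    also have "\<dots> \<le> q * sin t * cross (dir a) (z - x)"
      using c pq ct by (simp add: mult_nonneg_nonpos)
    finally have "0 \<le> (q * sin t) * cross (dir a) (z - x)" .
    moreover have "0 < q * sin t" using pq False st by simp
    ultimately have "0 \<le> cross (dir a) (z - x)" by (simp only: zero_le_mult_iff) linarith
    then show ?thesis by (simp add: cross_diff)
  qed
  have v: "0 \<le> dir (a + t) \<bullet> (y - z)"
    using y Z(1) by (simp add: start_point_def support_point_def inner_diff_right)
  have "p * (dir a \<bullet> (y - z)) + q * (dir (a + t) \<bullet> (y - z)) \<le> 0"
    using Z(3) yK by (auto simp: pq support_point_def inner_diff_right inner_add_left right_diff_distrib)
  then have "p * (dir a \<bullet> (y - z)) \<le> 0" using v pq mult_nonneg_nonneg by (smt (verit))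
  then have c: "dir a \<bullet> (y - z) \<le> 0" using pq by (simp add: mult_le_0_iff)
  have "0 \<le> cos t * (dir a \<bullet> (y - z)) + sin t * cross (dir a) (y - z)"
    using v by (simp add: dir_inner_shift)
  also have "\<dots> \<le> sin t * cross (dir a) (y - z)"
    using c ct by (simp add: mult_nonneg_nonpos)
  finally have "0 \<le> cross (dir a) (y - z)" using st by (simp add: zero_le_mult_iff)
  then show "cross (dir a) z \<le> cross (dir a) y" by (simp add: cross_diff)
qed

text \<open>
  Cutting the parameter interval into N equal pieces covers A by sets of diameter at most
  C (hi - lo) / N, and these bounds add up to C (hi - lo) for every N.
\<close>

lemma hausdorff_1_le_of_parametrization:
  fixes A :: "'a::euclidean_space set" and \<sigma> :: "'a \<Rightarrow> real"
  assumes range: "\<And>x. x \<in> A \<Longrightarrow> \<sigma> x \<in> {lo..hi}"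
    and expand: "\<And>x y. x \<in> A \<Longrightarrow> y \<in> A \<Longrightarrow> norm (y - x) \<le> C * \<bar>\<sigma> y - \<sigma> x\<bar>"
    and C: "0 < C" and lohi: "lo \<le> hi"
  shows "hausdorff_outer_measure 1 A \<le> ennreal (C * (hi - lo))"
  unfolding hausdorff_outer_measure_def
proof (rule SUP_least)
  fix \<delta> :: real assume "\<delta> \<in> {0<..}"
  then have \<delta>: "0 < \<delta>" by simp
  define D where "D = hi - lo"
  have D: "0 \<le> D" using lohi by (simp add: D_def)
  obtain N :: nat where N: "C * D / \<delta> < N" using reals_Archimedean2 by blast
  have N0: "0 < real N"
    by (rule le_less_trans[OF _ N]) (use C D \<delta> in auto)
  have small: "C * (D / N) \<le> \<delta>" using N N0 \<delta> by (simp add: field_simps)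
  define U where "U i = (if i < N then {x \<in> A. \<sigma> x \<in> {lo + i * (D / N)..lo + (i + 1) * (D / N)}} else {})" for i :: nat
  have diam_le: "norm (x - y) \<le> C * (D / N)" if "x \<in> U i" "y \<in> U i" for x y i
  proof -
    have xy: "x \<in> A" "y \<in> A" "\<bar>\<sigma> x - \<sigma> y\<bar> \<le> D / N"
      using that by (auto simp: U_def abs_le_iff algebra_simps add_divide_distrib split: if_splits)
    show ?thesis
      using order_trans[OF expand[OF xy(2,1)] mult_left_mono[OF xy(3)]] C by simp
  qed
  have diam: "diameter (U i) \<le> C * (D / N)" for i
    using C D diam_le by (intro diameter_le) auto
  have bdd: "bounded (U i)" for i
  proof (cases "U i = {}")
    case False
    then obtain x where x: "x \<in> U i" by blast
    then show ?thesis unfolding bounded_def using diam_le[OF x]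
      by (intro exI[of _ x] exI[of _ "C * (D / N)"]) (simp add: dist_norm)
  qed simp
  have cover: "A \<subseteq> (\<Union>i. U i)"
  proof
    fix x assume x: "x \<in> A"
    show "x \<in> (\<Union>i. U i)"
    proof (cases "D = 0")
      case True
      then have "x \<in> U 0" using x range[OF x] N0 by (auto simp: U_def D_def)
      then show ?thesis by blast
    next
      case False
      with D have D: "0 < D" by simp
      define s where "s = (\<sigma> x - lo) * N / D"
      have s: "0 \<le> s" "s \<le> N" using range[OF x] D N0 by (auto simp: s_def D_def field_simps)
      define i where "i = (if s = N then N - 1 else nat \<lfloor>s\<rfloor>)"
      have i: "i < N" "real i \<le> s" "s \<le> real i + 1"
        using s N0 by (auto simp: i_def of_nat_diff) linarith+
      have "\<sigma> x = lo + s * (D / N)" using D N0 by (simp add: s_def)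
      then have "x \<in> U i"
        using x i D N0 by (auto simp: U_def intro!: mult_right_mono divide_right_mono)
      then show ?thesis by blast
    qed
  qed
  have "hausdorff_pre_measure 1 \<delta> A \<le> (\<Sum>i. hausdorff_weight 1 (U i))"
    unfolding hausdorff_pre_measure_def
    using cover bdd order_trans[OF diam small] by (intro INF_lower) auto
  also have "\<dots> = (\<Sum>i<N. hausdorff_weight 1 (U i))"
    by (intro suminf_finite) (auto simp: U_def hausdorff_weight_def)
  also have "\<dots> \<le> (\<Sum>i<N. ennreal (C * (D / N)))"
    using diam by (intro sum_mono) (auto simp: hausdorff_weight_def intro: ennreal_leI)
  also have "\<dots> = ennreal (C * D)"
    using N0 C D by (simp add: ennreal_of_nat_eq_real_of_nat flip: ennreal_mult)
  finally show "hausdorff_pre_measure 1 \<delta> A \<le> ennreal (C * (hi - lo))" by (simp add: D_def)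
qed

text \<open>
  The boundary points with normals in the arc form a graph over the tangent line with Lipschitz
  constant tan t, lying above the interval cut out by the two support points; so the length is at most
  the length of that interval divided by cos t.
\<close>

lemma hausdorff_gauss_preimage_le:
  assumes K: "compact K" and t: "0 < t" "t < pi / 2"
    and x: "start_point K (dir a) x" and y: "start_point K (dir (a + t)) y"
  shows "hausdorff_outer_measure 1 (gauss_preimage K (circle_arc a (a + t))) \<le> ennreal (cross (dir a) (y - x) / cos t)"
proof (cases "gauss_preimage K (circle_arc a (a + t)) = {}")
  case True
  have "hausdorff_outer_measure 1 ({} :: (real^2) set) \<le> ennreal (1 * (0 - 0))"
    by (rule hausdorff_1_le_of_parametrization[where \<sigma> = "\<lambda>_. 0"]) auto
  then show ?thesis using True by simp
next
  case False
  have ct: "0 < cos t" using t by (intro cos_gt_zero_pi) auto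
  have "hausdorff_outer_measure 1 (gauss_preimage K (circle_arc a (a + t)))
      \<le> ennreal (1 / cos t * (cross (dir a) y - cross (dir a) x))"
  proof (rule hausdorff_1_le_of_parametrization[where \<sigma> = "cross (dir a)"])
    show "cross (dir a) x \<le> cross (dir a) y"
      using False gauss_preimage_between[OF K t x y] by (meson all_not_in_conv order_trans)
  qed (use gauss_preimage_between[OF K t x y] gauss_preimage_norm_le[OF K t] ct in auto)
  also have "cross (dir a) y - cross (dir a) x = cross (dir a) (y - x)"
    by (simp add: coords algebra_simps)
  finally show ?thesis by simp
qed

section \<open>Cones over pieces of the boundary\<close>

definition radial_hull :: "'a::real_vector set \<Rightarrow> 'a set" where
  "radial_hull W = {s *\<^sub>R p |s p. 0 \<le> s \<and> s \<le> 1 \<and> p \<in> W}"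

lemma supporting_normal_exists:
  fixes K :: "'a::euclidean_space set"
  assumes K: "compact K" "convex K" "interior K \<noteq> {}" and x: "x \<in> frontier K"
  obtains u where "outer_unit_normal K x u"
proof -
  have xK: "x \<in> K" using x frontier_subset_closed[OF compact_imp_closed[OF K(1)]] by blast
  have "x \<notin> rel_interior K"
    using x rel_interior_nonempty_interior[OF K(3)] by (simp add: frontier_def)
  from supporting_hyperplane_rel_boundary[OF K(2) xK this]
  obtain a where a: "a \<noteq> 0" "\<And>y. y \<in> K \<Longrightarrow> a \<bullet> x \<le> a \<bullet> y" by metis
  have "outer_unit_normal K x (- (a /\<^sub>R norm a))"
    unfolding outer_unit_normal_def
  proof (intro conjI ballI)
    show "norm (- (a /\<^sub>R norm a)) = 1" using a(1) by simp
    fix y assume "y \<in> K"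
    from mult_left_mono[OF a(2)[OF this], of "inverse (norm a)"]
    show "- (a /\<^sub>R norm a) \<bullet> y \<le> - (a /\<^sub>R norm a) \<bullet> x" by simp
  qed
  then show ?thesis by (rule that)
qed

text \<open>
  Two parallel normals are opposite, and then K would lie in a line.
\<close>

lemma two_normals_independent:
  assumes K: "sym_body K" and u: "outer_unit_normal K x u" and v: "outer_unit_normal K x v" and uv: "u \<noteq> v"
  shows "cross u v \<noteq> 0"
proof
  assume 0: "cross u v = 0"
  have nu: "u \<bullet> u = 1" and nv: "v \<bullet> v = 1"
    using u v by (auto simp: outer_unit_normal_def norm_eq_1)
  have "(u \<bullet> v)\<^sup>2 = 1"
    using cross_Lagrange[of u v u v] 0 nu nv by (simp add: inner_commute power2_eq_square)
  then have "u \<bullet> v = 1 \<or> u \<bullet> v = - 1" by (simp add: power2_eq_1_iff)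
  then show False
  proof
    assume "u \<bullet> v = 1"
    then have "(u - v) \<bullet> (u - v) = 0" using nu nv by (simp add: inner_diff_left inner_diff_right inner_commute)
    then show False using uv by simp
  next
    assume "u \<bullet> v = - 1"
    then have "(u + v) \<bullet> (u + v) = 0" using nu nv by (simp add: inner_add_left inner_add_right inner_commute)
    then have vu: "v = - u" by (simp add: add_eq_0_iff)
    obtain r where r: "0 < r" "cball 0 r \<subseteq> K" using sym_body_radii[OF K] by metis
    have "r *\<^sub>R u \<in> K" "(- r) *\<^sub>R u \<in> K"
      using r u by (auto simp: outer_unit_normal_def)
    then have "u \<bullet> (r *\<^sub>R u) \<le> u \<bullet> x" "v \<bullet> ((- r) *\<^sub>R u) \<le> v \<bullet> x"
      using u v unfolding outer_unit_normal_def by blast+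
    then show False using r nu by (simp add: vu)
  qed
qed

text \<open>
  At a boundary point with two normals u and v every positive combination of u and v is
  maximised over K at that point only. These combinations form a nonempty open set, so one of them
  belongs to a fixed countable dense set, and it determines the point.
\<close>

lemma countable_nonregular:
  fixes K :: "(real^2) set"
  assumes K: "sym_body K"
  shows "countable (frontier K - regular_boundary K)"
proof -
  let ?N = "frontier K - regular_boundary K"
  obtain D :: "(real^2) set" where D: "countable D" "\<And>X. open X \<Longrightarrow> X \<noteq> {} \<Longrightarrow> \<exists>d\<in>D. d \<in> X"
    using countable_dense_exists[where 'a = "real^2"] by blast
  have "\<exists>w\<in>D. \<forall>y\<in>K. y \<noteq> x \<longrightarrow> w \<bullet> y < w \<bullet> x" if x: "x \<in> ?N" for x
  proof -
    obtain u where u: "outer_unit_normal K x u"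
      using supporting_normal_exists[OF sym_body_compact[OF K] sym_body_convex[OF K] sym_body_interior[OF K], of x] x
      by blast
    then obtain v where v: "outer_unit_normal K x v" "u \<noteq> v"
      using x by (auto simp: regular_boundary_def)
    define k where "k = cross u v"
    have k: "k \<noteq> 0" using two_normals_independent[OF K u v] by (simp add: k_def)
    define X where "X = {w. 0 < cross w v * k} \<inter> {w. 0 < cross u w * k}"
    have "open X" unfolding X_def cross_def
      by (intro open_Int open_Collect_less continuous_intros)
    moreover have "u + v \<in> X"
    proof -
      have "cross (u + v) v = k" "cross u (u + v) = k" by (simp_all add: k_def coords algebra_simps)
      then show ?thesis using k by (simp add: X_def) (metis not_real_square_gt_zero)
    qed
    ultimately obtain w where w: "w \<in> D" "w \<in> X" using D(2) by blast
    define p q where "p = cross w v / k" and "q = cross u w / k"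
    have pq: "0 < p" "0 < q" using w k
      by (auto simp: X_def p_def q_def zero_less_mult_iff zero_less_divide_iff)
    have wpq: "w = p *\<^sub>R u + q *\<^sub>R v"
      using cross_basis_expansion[of u v w] k by (simp add: p_def q_def k_def)
    have "w \<bullet> y < w \<bullet> x" if y: "y \<in> K" "y \<noteq> x" for y
    proof -
      have le: "u \<bullet> y \<le> u \<bullet> x" "v \<bullet> y \<le> v \<bullet> x" using u v y by (auto simp: outer_unit_normal_def)
      have "u \<bullet> (x - y) \<noteq> 0 \<or> v \<bullet> (x - y) \<noteq> 0"
      proof (rule ccontr)
        assume "\<not> ?thesis"
        then have e: "u$1 * (x - y)$1 + u$2 * (x - y)$2 = 0" "v$1 * (x - y)$1 + v$2 * (x - y)$2 = 0"
          by (simp_all add: inner_coords)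
        have "k * (x - y)$1 = 0" "k * (x - y)$2 = 0"
          unfolding k_def cross_def using e by algebra+
        then show False using k y by (simp add: vec2_eq_iff)
      qed
      then have "p * (u \<bullet> y) + q * (v \<bullet> y) < p * (u \<bullet> x) + q * (v \<bullet> x)"
      proof
        assume "u \<bullet> (x - y) \<noteq> 0"
        then have "u \<bullet> y < u \<bullet> x" using le(1) by (simp add: inner_diff_right)
        then show ?thesis using le(2) pq by (intro add_less_le_mono) auto
      next
        assume "v \<bullet> (x - y) \<noteq> 0"
        then have "v \<bullet> y < v \<bullet> x" using le(2) by (simp add: inner_diff_right)
        then show ?thesis using le(1) pq by (intro add_le_less_mono) auto
      qed
      then show ?thesis by (simp add: wpq inner_add_left)
    qed
    then show ?thesis using w(1) by blast
  qed
  then obtain f where f: "\<And>x. x \<in> ?N \<Longrightarrow> f x \<in> D" "\<And>x y. x \<in> ?N \<Longrightarrow> y \<in> K \<Longrightarrow> y \<noteq> x \<Longrightarrow> f x \<bullet> y < f x \<bullet> x"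
    by metis
  have NK: "?N \<subseteq> K" using compact_imp_closed[OF sym_body_compact[OF K]] frontier_subset_closed by blast
  have "inj_on f ?N"
  proof (rule inj_onI, rule ccontr)
    fix x y assume xy: "x \<in> ?N" "y \<in> ?N" "f x = f y" "x \<noteq> y"
    then show False using f(2)[of x y] f(2)[of y x] NK by force
  qed
  moreover have "f ` ?N \<subseteq> D" using f(1) by blast
  then have "countable (f ` ?N)" using D(1) by (rule countable_subset)
  ultimately show ?thesis by (rule countable_image_inj_on[rotated])
qed

lemma body_subset_cone_frontier:
  assumes K: "sym_body K"
  shows "K - {0} \<subseteq> radial_hull (frontier K)"
proof
  fix z assume z: "z \<in> K - {0}"
  then have z0: "z \<noteq> 0" by simp
  obtain d where d: "0 < d" "0 + d *\<^sub>R z \<in> frontier K"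
    using ray_to_frontier[OF compact_imp_bounded[OF sym_body_compact[OF K]] sym_body_zero_interior[OF K] z0] by metis
  have "1 \<le> d"
  proof (rule ccontr)
    assume "\<not> 1 \<le> d"
    then have "z - (1 - d) *\<^sub>R (z - 0) \<in> interior K"
      using z d by (intro mem_interior_convex_shrink sym_body_convex[OF K] sym_body_zero_interior[OF K]) auto
    then have "d *\<^sub>R z \<in> interior K" by (simp add: algebra_simps)
    then show False using d(2) by (simp add: frontier_def)
  qed
  then show "z \<in> radial_hull (frontier K)"
    using d by (auto simp: radial_hull_def intro!: exI[of _ "1 / d"] exI[of _ "d *\<^sub>R z"])
qed

lemma negligible_cone_countable:
  assumes "countable N"
  shows "negligible (radial_hull N :: (real^2) set)"
proof -
  have "negligible (\<Union>p\<in>N. radial_hull {p})"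
  proof (rule negligible_countable_Union)
    fix S assume "S \<in> (\<lambda>p. radial_hull {p}) ` N"
    then obtain p where S: "S = radial_hull {p}" by blast
    show "negligible S"
    proof (cases "p = 0")
      case True
      then have "S \<subseteq> {0}" by (auto simp: S radial_hull_def)
      then show ?thesis using negligible_subset negligible_sing by blast
    next
      case False
      have "S \<subseteq> {z. cross p z = 0}" by (auto simp: S radial_hull_def coords)
      then show ?thesis using negligible_subset[OF negligible_line[OF False]] by blast
    qed
  qed (use assms in simp)
  moreover have "(\<Union>p\<in>N. radial_hull {p}) = radial_hull N" by (auto simp: radial_hull_def)
  ultimately show ?thesis by simp
qed

text \<open>
  In coordinates along u and orthogonal to u, a point p of W is seen from the origin under the
  slope \<tau> p. The height u \<bullet> p lies between g and h and W is nearly orthogonal to u, so the slope is Lipschitz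
  with constant \<kappa>, which is about 1 / h. Hence the cone over W lies in the triangle of height h whose
  sides have slopes \<tau>0 and \<tau>0 + \<kappa> d, where d is the diameter of W, and its area is about h d / 2.
\<close>

lemma cone_subset_triangle:
  assumes K: "sym_body K" and R: "\<And>x. x \<in> K \<Longrightarrow> norm x \<le> R" and t: "0 < t" "t < pi / 2"
    and h: "h = support_fun K (dir a)" and g: "g = h - 2 * R * t" "0 < g"
    and W: "W \<subseteq> gauss_preimage K (circle_arc a (a + t))" "W \<noteq> {}" "bounded W"
  obtains M where "compact M" "radial_hull W \<subseteq> M"
    "vol M = h / 2 * (h / g * (1 + R * tan t / g)) * diameter W"
proof -
  define u where "u = dir a"
  define d where "d = diameter W"
  have d0: "0 \<le> d" unfolding d_def by (rule diameter_ge_0[OF W(3)])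
  have uu: "u \<bullet> u = 1" by (simp add: u_def flip: norm_eq_1)
  have KC: "compact K" by (rule sym_body_compact[OF K])
  have WK: "p \<in> K" if "p \<in> W" for p using gauss_preimageD(1)[OF KC] W(1) that by blast
  have R0: "0 \<le> R" using W(2) WK R norm_ge_zero order_trans by (metis all_not_in_conv)
  have tn: "0 \<le> tan t" using t by (simp add: less_imp_le tan_gt_zero)
  have h0: "0 < h" using g R0 t by (smt (verit) mult_nonneg_nonneg)
  have up: "g \<le> u \<bullet> p" "u \<bullet> p \<le> h" if p: "p \<in> W" for p
  proof -
    define w where "w = gauss_map K p"
    have G: "w \<in> circle_arc a (a + t)" "support_point K w p"
      using gauss_preimageD[OF KC, of p] W(1) p by (auto simp: w_def)
    have wu: "norm (w - u) \<le> t" using arc_norm_diff[OF G(1)] by (simp add: u_def)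
    have "h \<le> support_fun K w + R * norm (u - w)"
      unfolding h u_def by (rule support_fun_Lipschitz[OF KC sym_body_nonempty[OF K] R])
    moreover have "R * norm (u - w) \<le> R * t" using wu R0 by (intro mult_left_mono) (auto simp: norm_minus_commute)
    moreover have "(w - u) \<bullet> p \<le> norm (w - u) * norm p" by (rule norm_cauchy_schwarz)
    moreover have "norm (w - u) * norm p \<le> t * R" using wu R[OF WK[OF p]] t by (intro mult_mono) auto
    ultimately show "g \<le> u \<bullet> p"
      using support_fun_eq[OF G(2)] by (simp add: g(1) inner_diff_left algebra_simps)
    show "u \<bullet> p \<le> h" unfolding h u_def by (rule inner_le_support_fun[OF KC WK[OF p]])
  qed
  define \<kappa> where "\<kappa> = (1 + R * tan t / g) / g"
  have k0: "0 < \<kappa>" using g R0 tn by (simp add: \<kappa>_def add_pos_nonneg)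
  define \<tau> where "\<tau> p = cross u p / (u \<bullet> p)" for p
  have tau: "\<tau> p - \<tau> q \<le> \<kappa> * d" if p: "p \<in> W" and q: "q \<in> W" for p q
  proof -
    define e where "e = p - q"
    have pe: "p = q + e" by (simp add: e_def)
    have pos: "0 < u \<bullet> p" "0 < u \<bullet> q" using up[OF p] up[OF q] g by auto
    have ed: "norm e \<le> d" using diameter_bounded_bound[OF W(3) p q] by (simp add: d_def e_def dist_norm)
    have c1: "\<bar>cross u e\<bar> \<le> norm e"
    proof -
      have "(cross u e)\<^sup>2 \<le> (norm e)\<^sup>2" by (simp add: norm_dir_decompose[of e a] u_def)
      then show ?thesis using abs_le_square_iff[of "cross u e" "norm e"] by simp
    qed
    have c2: "\<bar>u \<bullet> e\<bar> \<le> tan t * norm e"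
    proof -
      have "p \<in> gauss_preimage K (circle_arc a (a + t))" "q \<in> gauss_preimage K (circle_arc a (a + t))"
        using W(1) p q by auto
      from gauss_preimage_flat[OF KC t this(2,1)] mult_left_mono[OF c1 tn]
      show ?thesis by (simp add: e_def u_def)
    qed
    have c3: "\<bar>cross u q\<bar> \<le> R"
    proof -
      have "(cross u q)\<^sup>2 \<le> (norm q)\<^sup>2" by (simp add: norm_dir_decompose[of q a] u_def)
      then have "\<bar>cross u q\<bar> \<le> norm q" using abs_le_square_iff[of "cross u q" "norm q"] by simp
      then show ?thesis using R[OF WK[OF q]] by simp
    qed
    have "\<tau> p - \<tau> q = cross u e / (u \<bullet> p) - (cross u q / (u \<bullet> q)) * ((u \<bullet> e) / (u \<bullet> p))"
      using pos by (simp add: \<tau>_def field_simps) (simp add: pe coords algebra_simps)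
    also have "\<dots> \<le> norm e / g + (R / g) * (tan t * norm e / g)"
    proof -
      have "cross u e / (u \<bullet> p) \<le> \<bar>cross u e\<bar> / (u \<bullet> p)" using pos by (simp add: divide_right_mono)
      also have "\<dots> \<le> norm e / g" using c1 up(1)[OF p] g by (intro frac_le) auto
      finally have 1: "cross u e / (u \<bullet> p) \<le> norm e / g" .
      have "- ((cross u q / (u \<bullet> q)) * ((u \<bullet> e) / (u \<bullet> p))) \<le> \<bar>(cross u q / (u \<bullet> q)) * ((u \<bullet> e) / (u \<bullet> p))\<bar>"
        by (rule abs_ge_minus_self)
      also have "\<dots> = (\<bar>cross u q\<bar> / (u \<bullet> q)) * (\<bar>u \<bullet> e\<bar> / (u \<bullet> p))" using pos by (simp add: abs_mult)
      also have "\<dots> \<le> (R / g) * (tan t * norm e / g)"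
        using c2 c3 up(1)[OF p] up(1)[OF q] g R0 tn pos by (intro mult_mono frac_le) auto
      finally show ?thesis using 1 by simp
    qed
    also have "\<dots> = \<kappa> * norm e" using g by (simp add: \<kappa>_def field_simps)
    also have "\<dots> \<le> \<kappa> * d" using ed k0 by simp
    finally show ?thesis .
  qed
  \<comment> \<open>The least slope, not the slope of some point of W: otherwise the range of slopes would double.\<close>
  define \<tau>0 where "\<tau>0 = Inf (\<tau> ` W)"
  obtain q0 where q0: "q0 \<in> W" using W(2) by blast
  have bdd: "bdd_below (\<tau> ` W)"
    unfolding bdd_below_def using tau[OF q0] by (intro exI[of _ "\<tau> q0 - \<kappa> * d"]) force
  have t0: "\<tau>0 \<le> \<tau> p" "\<tau> p \<le> \<tau>0 + \<kappa> * d" if p: "p \<in> W" for p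
  proof -
    show "\<tau>0 \<le> \<tau> p" unfolding \<tau>0_def using p bdd by (intro cInf_lower) auto
    have "\<tau> p - \<kappa> * d \<le> \<tau>0" unfolding \<tau>0_def
      using W(2) tau[OF p] by (intro cInf_greatest) force+
    then show "\<tau> p \<le> \<tau>0 + \<kappa> * d" by simp
  qed
  define A B where "A = h *\<^sub>R (u + \<tau>0 *\<^sub>R perp u)" and "B = h *\<^sub>R (u + (\<tau>0 + \<kappa> * d) *\<^sub>R perp u)"
  show ?thesis
  proof (rule that[of "triangle0 A B"])
    show "radial_hull W \<subseteq> triangle0 A B"
    proof
      fix z assume "z \<in> radial_hull W"
      then obtain s p where sp: "0 \<le> s" "s \<le> 1" "p \<in> W" "z = s *\<^sub>R p" by (auto simp: radial_hull_def)
      have pos: "0 < u \<bullet> p" using up[OF sp(3)] g by auto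
      define l where "l = (\<tau> p - \<tau>0) / (\<kappa> * d)"
      have l: "0 \<le> l" "l \<le> 1" using t0[OF sp(3)] k0 d0 by (auto simp: l_def divide_le_eq)
      have lt: "l * (\<kappa> * d) = \<tau> p - \<tau>0" using t0[OF sp(3)] by (cases "\<kappa> * d = 0") (auto simp: l_def)
      define k where "k = s * (u \<bullet> p) / h"
      have k: "0 \<le> k" "k \<le> 1"
        using sp pos h0 up(2)[OF sp(3)] by (auto simp: k_def divide_le_eq intro: order_trans[OF mult_left_le_one_le])
      have pexp: "p = (u \<bullet> p) *\<^sub>R (u + \<tau> p *\<^sub>R perp u)"
      proof (rule inner_perp_eqI[of u])
        show "u \<noteq> 0" using uu by auto
        have 1: "u \<bullet> perp u = 0" "perp u \<bullet> u = 0" "perp u \<bullet> perp u = 1"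
          using uu by (simp_all add: coords algebra_simps)
        show "u \<bullet> p = u \<bullet> ((u \<bullet> p) *\<^sub>R (u + \<tau> p *\<^sub>R perp u))"
          by (simp add: inner_add_right uu 1)
        show "perp u \<bullet> p = perp u \<bullet> ((u \<bullet> p) *\<^sub>R (u + \<tau> p *\<^sub>R perp u))"
          using pos by (simp add: inner_add_right uu 1 \<tau>_def cross_eq_perp)
      qed
      have "(k * (1 - l)) *\<^sub>R A + (k * l) *\<^sub>R B = (k * h) *\<^sub>R (u + (\<tau>0 + l * (\<kappa> * d)) *\<^sub>R perp u)"
        by (simp add: A_def B_def algebra_simps)
      also have "\<dots> = s *\<^sub>R ((u \<bullet> p) *\<^sub>R (u + \<tau> p *\<^sub>R perp u))"
        using h0 by (simp add: lt k_def)
      finally have z: "z = (k * (1 - l)) *\<^sub>R A + (k * l) *\<^sub>R B" using pexp sp(4) by simp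
      have "z \<in> (\<lambda>z. 1 *\<^sub>R z + 0) ` triangle0 A B"
        using k l by (intro in_scaled_triangle0[OF z]) (auto simp: algebra_simps mult_left_le)
      then show "z \<in> triangle0 A B" by simp
    qed
    have "cross A B = h * h * (\<kappa> * d) * (u \<bullet> u)"
      by (simp add: A_def B_def coords algebra_simps)
    then have "cross A B = h * h * (\<kappa> * d)" by (simp add: uu)
    moreover have "0 \<le> h * h * (\<kappa> * d)" using h0 k0 d0 by auto
    ultimately have "vol (triangle0 A B) = h * h * (\<kappa> * d) / 2"
      by (simp add: vol_triangle0)
    also have "\<dots> = h / 2 * (h / g * (1 + R * tan t / g)) * d"
    proof -
      have "h * h * (Z / g * d) / 2 = h / 2 * (h / g * Z) * d" for Z by simp
      then show ?thesis unfolding \<kappa>_def .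
    qed
    finally show "vol (triangle0 A B) = h / 2 * (h / g * (1 + R * tan t / g)) * diameter W"
      unfolding d_def .
  qed simp
qed

text \<open>
  Applying the estimate for triangles to the members of a nearly optimal covering bounds the area
  of the cone from above by the Hausdorff measure.
\<close>

lemma cone_cover:
  assumes K: "sym_body K" and R: "\<And>x. x \<in> K \<Longrightarrow> norm x \<le> R" and t: "0 < t" "t < pi / 2"
    and h: "h = support_fun K (dir a)" and g: "g = h - 2 * R * t" "0 < g"
    and H: "hausdorff_outer_measure 1 (gauss_preimage K (circle_arc a (a + t))) = ennreal H" "0 \<le> H"
    and \<eta>: "0 < \<eta>" and R0: "0 \<le> R"
  obtains M where "M \<in> sets borel" "radial_hull (gauss_preimage K (circle_arc a (a + t))) \<subseteq> M"
    "emeasure lborel M \<le> ennreal (h / 2 * (h / g * (1 + R * tan t / g)) * (H + \<eta>))"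
proof -
  define A where "A = gauss_preimage K (circle_arc a (a + t))"
  define c where "c = h / 2 * (h / g * (1 + R * tan t / g))"
  have h0: "0 < h" using g R0 t by (smt (verit) mult_nonneg_nonneg)
  have tn: "0 \<le> tan t" using t by (simp add: less_imp_le tan_gt_zero)
  have c0: "0 \<le> c" using h0 g R0 tn by (simp add: c_def)
  have "hausdorff_pre_measure 1 1 A \<le> hausdorff_outer_measure 1 A"
    unfolding hausdorff_outer_measure_def by (rule SUP_upper) simp
  also have "\<dots> < ennreal (H + \<eta>)" using H \<eta> by (simp add: A_def ennreal_less_iff)
  finally have "hausdorff_pre_measure 1 1 A < ennreal (H + \<eta>)" .
  then obtain U :: "nat \<Rightarrow> (real^2) set" where
    U: "A \<subseteq> (\<Union>i. U i)" "\<And>i. bounded (U i)" "(\<Sum>i. hausdorff_weight 1 (U i)) < ennreal (H + \<eta>)"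
    unfolding hausdorff_pre_measure_def INF_less_iff by blast
  have "\<exists>M. compact M \<and> radial_hull (A \<inter> U i) \<subseteq> M \<and> emeasure lborel M \<le> ennreal c * hausdorff_weight 1 (U i)" for i
  proof (cases "A \<inter> U i = {}")
    case True
    then show ?thesis by (intro exI[of _ "{}"]) (auto simp: radial_hull_def)
  next
    case False
    have b: "bounded (A \<inter> U i)" using U(2) bounded_subset by blast
    obtain M where M: "compact M" "radial_hull (A \<inter> U i) \<subseteq> M" "vol M = c * diameter (A \<inter> U i)"
      using cone_subset_triangle[OF K R t h g, of "A \<inter> U i"] False b by (auto simp: A_def c_def)
    have "emeasure lborel M = ennreal (c * diameter (A \<inter> U i))"
      using vol_eq_emeasure[OF M(1)] M(3) by simp
    also have "\<dots> \<le> ennreal (c * diameter (U i))"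
      using c0 U(2) by (intro ennreal_leI mult_left_mono diameter_subset) auto
    also have "\<dots> = ennreal c * hausdorff_weight 1 (U i)"
      using False c0 by (auto simp: hausdorff_weight_def ennreal_mult' diameter_ge_0 U(2))
    finally show ?thesis using M by blast
  qed
  then obtain M where M: "\<And>i. compact (M i)" "\<And>i. radial_hull (A \<inter> U i) \<subseteq> M i"
    "\<And>i. emeasure lborel (M i) \<le> ennreal c * hausdorff_weight 1 (U i)" by metis
  show ?thesis
  proof (rule that[of "\<Union>i. M i"])
    show "(\<Union>i. M i) \<in> sets borel" using M(1) by (auto intro: borel_compact)
    show "radial_hull (gauss_preimage K (circle_arc a (a + t))) \<subseteq> (\<Union>i. M i)"
    proof
      fix z assume "z \<in> radial_hull (gauss_preimage K (circle_arc a (a + t)))"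
      then obtain s p where sp: "0 \<le> s" "s \<le> 1" "p \<in> A" "z = s *\<^sub>R p" by (auto simp: radial_hull_def A_def)
      then obtain i where "p \<in> U i" using U(1) by blast
      then have "z \<in> radial_hull (A \<inter> U i)" using sp by (auto simp: radial_hull_def)
      then show "z \<in> (\<Union>i. M i)" using M(2) by blast
    qed
    have "emeasure lborel (\<Union>i. M i) \<le> (\<Sum>i. emeasure lborel (M i))"
      using M(1) by (intro emeasure_subadditive_countably) (auto intro: borel_compact)
    also have "\<dots> \<le> (\<Sum>i. ennreal c * hausdorff_weight 1 (U i))"
      using M(3) by (intro suminf_le) auto
    also have "\<dots> = ennreal c * (\<Sum>i. hausdorff_weight 1 (U i))" by simp
    also have "\<dots> \<le> ennreal c * ennreal (H + \<eta>)" using U(3) by (intro mult_left_mono) auto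
    also have "\<dots> = ennreal (c * (H + \<eta>))" using c0 H \<eta> by (simp add: ennreal_mult)
    finally show "emeasure lborel (\<Union>i. M i) \<le> ennreal (h / 2 * (h / g * (1 + R * tan t / g)) * (H + \<eta>))"
      by (simp add: c_def)
  qed
qed

section \<open>Grid arcs and the surface area measure\<close>

lemma continuous_on_dir: "continuous_on A dir"
proof -
  have "continuous_on A (\<lambda>t. (\<lambda>(x, y). vector [x, y] :: real^2) (cos t, sin t))"
    by (rule continuous_on_compose2[OF continuous_vector_Pair]) (auto intro!: continuous_intros)
  then show ?thesis by (simp add: dir_def[abs_def])
qed

lemma circle_arc_sets: "circle_arc a b \<in> sets (restrict_space borel (sphere (0 :: real^2) 1))"
proof -
  have Ico: "{a..<b} = (\<Union>n::nat. {a..b - 1 / Suc n})"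
  proof
    show "{a..<b} \<subseteq> (\<Union>n::nat. {a..b - 1 / Suc n})"
    proof
      fix t assume t: "t \<in> {a..<b}"
      then obtain n where "inverse (real (Suc n)) < b - t" using reals_Archimedean[of "b - t"] by auto
      then show "t \<in> (\<Union>n::nat. {a..b - 1 / Suc n})" using t by (auto simp: inverse_eq_divide intro!: exI[of _ n])
    qed
    show "(\<Union>n::nat. {a..b - 1 / Suc n}) \<subseteq> {a..<b}"
    proof
      fix t assume "t \<in> (\<Union>n::nat. {a..b - 1 / Suc n})"
      then obtain n :: nat where n: "a \<le> t" "t \<le> b - 1 / Suc n" by auto
      have "0 < 1 / real (Suc n)" by simp
      then have "t < b" using n by linarith
      then show "t \<in> {a..<b}" using n by simp
    qed
  qed
  have "circle_arc a b = (\<Union>n::nat. dir ` {a..b - 1 / Suc n})"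
    unfolding circle_arc_def Ico image_UN ..
  also have "\<dots> \<in> sets borel"
    by (intro sets.countable_UN) (auto intro!: borel_compact compact_continuous_image continuous_on_dir)
  finally show ?thesis by (subst sets_restrict_space_iff) (auto simp: circle_arc_def)
qed

lemma dir_inj_on: "inj_on dir {0..<2 * pi}"
proof (rule inj_onI)
  fix s t assume st: "s \<in> {0..<2 * pi}" "t \<in> {0..<2 * pi}" "dir s = dir t"
  have "cos (s - t) = dir s \<bullet> dir t" by (simp add: coords cos_diff)
  also have "\<dots> = 1" using st(3) by (simp flip: norm_eq_1)
  finally obtain n :: int where n: "s - t = real_of_int n * 2 * pi"
    unfolding cos_one_2pi_int by blast
  have "\<bar>s - t\<bar> < 2 * pi" using st by auto
  then have "\<bar>real_of_int n\<bar> * (2 * pi) < 1 * (2 * pi)" by (simp add: n abs_mult)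
  then have "\<bar>real_of_int n\<bar> < 1" by (rule mult_right_less_imp_less) simp
  then have "n = 0" by linarith
  then show "s = t" using n by simp
qed

definition grid_arc :: "nat \<Rightarrow> nat \<Rightarrow> (real^2) set" where
  "grid_arc m j = circle_arc (j * (pi / m)) (j * (pi / m) + pi / m)"

lemma grid_arc_cover:
  assumes m: "0 < m"
  shows "(\<Union>j<2 * m. grid_arc m j) = sphere 0 1"
proof
  show "(\<Union>j<2 * m. grid_arc m j) \<subseteq> sphere 0 1" by (auto simp: grid_arc_def circle_arc_def)
  show "sphere 0 1 \<subseteq> (\<Union>j<2 * m. grid_arc m j)"
  proof
    fix w :: "real^2" assume "w \<in> sphere 0 1"
    then have "(w$1)\<^sup>2 + (w$2)\<^sup>2 = 1" by (simp add: norm_eq_1 inner_coords power2_eq_square)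
    then obtain t where t: "0 \<le> t" "t < 2 * pi" "w$1 = cos t" "w$2 = sin t" by (rule sincos_total_2pi)
    then have w: "w = dir t" by (simp add: coords)
    define j where "j = nat \<lfloor>t / (pi / m)\<rfloor>"
    have pos: "0 < pi / m" using m by simp
    have fl: "real j \<le> t / (pi / m)" "t / (pi / m) < real j + 1"
      using t(1) pos by (auto simp: j_def)
    have 1: "real j * (pi / m) \<le> t" using fl(1) pos by (simp only: pos_le_divide_eq)
    have 2: "t < (real j + 1) * (pi / m)" using fl(2) pos by (simp only: pos_divide_less_eq)
    then have 3: "t < real j * (pi / m) + pi / m" by (simp only: distrib_right mult_1)
    have "real j * (pi / m) < (2 * m) * (pi / m)" using 1 t(2) m by simp
    then have "real j < real (2 * m)" using pos by (simp only: mult_less_cancel_right_pos)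
    then have "j < 2 * m" by (simp only: of_nat_less_iff)
    moreover have "w \<in> grid_arc m j" unfolding grid_arc_def circle_arc_def w
      using 1 3 by (intro imageI) simp
    ultimately show "w \<in> (\<Union>j<2 * m. grid_arc m j)" by blast
  qed
qed

lemma grid_arc_disjoint:
  assumes m: "0 < m" and jk: "j < 2 * m" "k < 2 * m" "j \<noteq> k"
  shows "grid_arc m j \<inter> grid_arc m k = {}"
proof (rule ccontr)
  define \<alpha> where "\<alpha> = pi / m"
  have al: "0 < \<alpha>" using m by (simp add: \<alpha>_def)
  assume "\<not> ?thesis"
  then obtain w where w: "w \<in> grid_arc m j" "w \<in> grid_arc m k" by blast
  have param: "\<exists>s. real i * \<alpha> \<le> s \<and> s < (real i + 1) * \<alpha> \<and> w = dir s" if "w \<in> grid_arc m i" for i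
    using that unfolding grid_arc_def circle_arc_def \<alpha>_def[symmetric] distrib_right mult_1 by auto
  obtain s where s: "real j * \<alpha> \<le> s" "s < (real j + 1) * \<alpha>" "w = dir s" using param[OF w(1)] by blast
  obtain t where t: "real k * \<alpha> \<le> t" "t < (real k + 1) * \<alpha>" "w = dir t" using param[OF w(2)] by blast
  have eq: "dir s = dir t" using s t by simp
  have rng: "r \<in> {0..<2 * pi}" if "i < 2 * m" "real i * \<alpha> \<le> r" "r < (real i + 1) * \<alpha>" for i r
  proof -
    have "0 \<le> real i * \<alpha>" using al by simp
    moreover have "(real i + 1) * \<alpha> \<le> (2 * real m) * \<alpha>"
      using that(1) al by (intro mult_right_mono) linarith+
    moreover have "(2 * real m) * \<alpha> = 2 * pi" using m by (simp add: \<alpha>_def)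
    ultimately show ?thesis using that by simp
  qed
  have "s = t" by (rule inj_onD[OF dir_inj_on eq]) (use rng jk s t in auto)
  then have "real j * \<alpha> < (real k + 1) * \<alpha>" "real k * \<alpha> < (real j + 1) * \<alpha>" using s t by auto
  then have "real j < real k + 1" "real k < real j + 1" using al by (simp_all only: mult_less_cancel_right_pos)
  then show False using jk by linarith
qed

lemma space_surface_area [simp]: "space (surface_area_measure K) = sphere 0 1"
  by (simp add: surface_area_measure_def space_measure_of_conv)

lemma sets_surface_area [simp, measurable_cong]:
  "sets (surface_area_measure K) = sets (restrict_space borel (sphere 0 1))"
proof -
  have "sets (restrict_space borel (sphere (0::'a) 1)) \<subseteq> Pow (sphere 0 1)"
    using sets.space_closed[of "restrict_space borel (sphere (0::'a) 1)"] by (simp add: space_restrict_space)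
  moreover have "sigma_sets (sphere 0 1) (sets (restrict_space borel (sphere (0::'a) 1))) = sets (restrict_space borel (sphere 0 1))"
    using sets.sigma_sets_eq[of "restrict_space borel (sphere (0::'a) 1)"] by (simp add: space_restrict_space)
  ultimately show ?thesis by (simp add: surface_area_measure_def sets_measure_of_conv)
qed

text \<open>
  A measure generated from a set function that is not countably additive is the zero measure by
  convention; hence the two cases.
\<close>

lemma surface_area_measure_cases:
  fixes K :: "(real^2) set"
  obtains (zero) "\<And>\<omega>. emeasure (surface_area_measure K) \<omega> = 0"
  | (hausdorff) "\<And>\<omega>. \<omega> \<in> sets (restrict_space borel (sphere 0 1)) \<Longrightarrow>
      emeasure (surface_area_measure K) \<omega> = hausdorff_outer_measure 1 (gauss_preimage K \<omega>)"
proof (cases "measure_space (sphere 0 1) (sigma_sets (sphere 0 1) (sets (restrict_space borel (sphere (0::real^2) 1))))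
    (\<lambda>\<omega>. hausdorff_outer_measure (DIM(real^2) - 1) {x \<in> regular_boundary K. gauss_map K x \<in> \<omega>})")
  case True
  have "emeasure (surface_area_measure K) \<omega> = hausdorff_outer_measure 1 (gauss_preimage K \<omega>)"
    if "\<omega> \<in> sets (restrict_space borel (sphere 0 1))" for \<omega>
    using that True unfolding surface_area_measure_def emeasure_measure_of_conv
    by (auto simp: gauss_preimage_def)
  then show ?thesis by (rule hausdorff)
next
  case False
  then have "emeasure (surface_area_measure K) \<omega> = 0" for \<omega>
    unfolding surface_area_measure_def emeasure_measure_of_conv by auto
  then show ?thesis by (rule zero)
qed

section \<open>Integrals of support functions\<close>

text \<open>
  Since x is extremal in the first direction and y in the second, y - x has a nonpositive component
  along the first and a nonnegative one along the second. So it points counterclockwise, within an angle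
  t of the tangent direction.
\<close>

lemma support_edge:
  assumes t: "0 < t" "t < pi / 2"
    and x: "support_point K (dir a) x" and y: "support_point K (dir (a + t)) y"
  shows "0 \<le> cross (dir a) (y - x)" "\<bar>dir a \<bullet> (y - x)\<bar> \<le> tan t * cross (dir a) (y - x)"
proof -
  define e where "e = y - x"
  have ct: "0 < cos t" and st: "0 < sin t" using t by (auto intro: cos_gt_zero_pi sin_gt_zero)
  have c: "dir a \<bullet> e \<le> 0" and v: "0 \<le> dir (a + t) \<bullet> e"
    using x y by (auto simp: support_point_def e_def inner_diff_right)
  have "0 \<le> cos t * (dir a \<bullet> e) + sin t * cross (dir a) e" using v by (simp add: dir_inner_shift)
  also have "\<dots> \<le> sin t * cross (dir a) e" using c ct by (simp add: mult_nonneg_nonpos)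
  finally have s: "0 \<le> cross (dir a) e" using st by (simp add: zero_le_mult_iff)
  have "\<bar>dir a \<bullet> e\<bar> \<le> tan t * \<bar>cross (dir a) e\<bar>"
    by (rule chord_flat[of t "dir a" 1 a 0 e "dir (a + t)" 0 1]) (use t c v in auto)
  then show "\<bar>dir a \<bullet> (y - x)\<bar> \<le> tan t * cross (dir a) (y - x)" using s by (simp add: e_def)
  show "0 \<le> cross (dir a) (y - x)" using s by (simp add: e_def)
qed

text \<open>
  For e exactly orthogonal to the direction at angle a, the area cross z e would be the height of
  z in that direction times the length of e; the term with T accounts for the tilt of e.
\<close>

lemma cross_edge_lower:
  assumes e: "0 \<le> cross (dir a) e" "\<bar>dir a \<bullet> e\<bar> \<le> T * cross (dir a) e"
    and z: "norm z \<le> R" "h \<le> dir a \<bullet> z" and T: "0 \<le> T"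
  shows "(h - R * T) * cross (dir a) e \<le> cross z e"
proof -
  have "cross z e = ((sin a)\<^sup>2 + (cos a)\<^sup>2) * cross z e" by simp
  also have "\<dots> = (dir a \<bullet> z) * cross (dir a) e - cross (dir a) z * (dir a \<bullet> e)"
    by (simp add: coords del: sin_cos_squared_add sin_cos_squared_add2) algebra
  finally have id: "cross z e = (dir a \<bullet> z) * cross (dir a) e - cross (dir a) z * (dir a \<bullet> e)" .
  have "(cross (dir a) z)\<^sup>2 \<le> (norm z)\<^sup>2" by (simp add: norm_dir_decompose[of z a])
  then have "\<bar>cross (dir a) z\<bar> \<le> R" using abs_le_square_iff[of "cross (dir a) z" "norm z"] z(1) by simp
  then have "\<bar>cross (dir a) z\<bar> * \<bar>dir a \<bullet> e\<bar> \<le> R * (T * cross (dir a) e)"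
    using e by (intro mult_mono) auto
  then have "cross (dir a) z * (dir a \<bullet> e) \<le> R * T * cross (dir a) e"
    using abs_ge_self[of "cross (dir a) z * (dir a \<bullet> e)"] by (simp add: abs_mult)
  moreover have "h * cross (dir a) e \<le> (dir a \<bullet> z) * cross (dir a) e"
    using z(2) e(1) by (intro mult_right_mono)
  ultimately show ?thesis by (simp add: id algebra_simps)
qed

lemma sum_lessThan_add: "(\<Sum>j<m + n. g j) = (\<Sum>j<m. g j) + (\<Sum>j<n. g (j + m :: nat) :: real)"
  by (induction n) (auto simp: add.commute)

lemma integral_partition_bounds:
  fixes f c :: "_ \<Rightarrow> real"
  assumes M: "finite_measure M" and f: "integrable M f" and I: "finite I"
    and E: "\<And>j. j \<in> I \<Longrightarrow> E j \<in> sets M" "(\<Union>j\<in>I. E j) = space M"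
    and disj: "\<And>j k. j \<in> I \<Longrightarrow> k \<in> I \<Longrightarrow> j \<noteq> k \<Longrightarrow> E j \<inter> E k = {}"
  shows "(\<And>j w. j \<in> I \<Longrightarrow> w \<in> E j \<Longrightarrow> f w \<le> c j) \<Longrightarrow> integral\<^sup>L M f \<le> (\<Sum>j\<in>I. c j * measure M (E j))"
    and "(\<And>j w. j \<in> I \<Longrightarrow> w \<in> E j \<Longrightarrow> c j \<le> f w) \<Longrightarrow> (\<Sum>j\<in>I. c j * measure M (E j)) \<le> integral\<^sup>L M f"
proof -
  interpret finite_measure M by fact
  define s where "s w = (\<Sum>j\<in>I. c j * indicator (E j) w)" for w
  have fin: "emeasure M (E j) < \<infinity>" for j 
    unfolding infinity_ennreal_def less_top[symmetric] by (rule emeasure_finite)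
  have sint: "integrable M s" unfolding s_def
    using E(1) fin by (intro Bochner_Integration.integrable_sum integrable_mult_right integrable_real_indicator) auto
  have sval: "integral\<^sup>L M s = (\<Sum>j\<in>I. c j * measure M (E j))"
    unfolding s_def using E(1) fin
    by (subst Bochner_Integration.integral_sum) (auto intro!: sum.cong integrable_mult_right integrable_real_indicator)
  have seq: "s w = c j" if "j \<in> I" "w \<in> E j" for w j
  proof -
    have "s w = (\<Sum>k\<in>I. if k = j then c j else 0)"
      unfolding s_def using disj that by (intro sum.cong) (auto simp: indicator_def)
    then show ?thesis using that I by simp
  qed
  show "integral\<^sup>L M f \<le> (\<Sum>j\<in>I. c j * measure M (E j))"
    if *: "\<And>j w. j \<in> I \<Longrightarrow> w \<in> E j \<Longrightarrow> f w \<le> c j"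
    unfolding sval[symmetric]
  proof (rule integral_mono[OF f sint])
    fix w assume "w \<in> space M"
    then obtain j where "j \<in> I" "w \<in> E j" using E(2) by blast
    then show "f w \<le> s w" using * seq by simp
  qed
  show "(\<Sum>j\<in>I. c j * measure M (E j)) \<le> integral\<^sup>L M f"
    if *: "\<And>j w. j \<in> I \<Longrightarrow> w \<in> E j \<Longrightarrow> c j \<le> f w"
    unfolding sval[symmetric]
  proof (rule integral_mono[OF sint f])
    fix w assume "w \<in> space M"
    then obtain j where "j \<in> I" "w \<in> E j" using E(2) by blast
    then show "s w \<le> f w" using * seq by simp
  qed
qed

lemma continuous_on_support_fun:
  assumes K: "compact K" "K \<noteq> {}"
  shows "continuous_on A (support_fun K)"
proof -
  obtain R where R: "\<And>x. x \<in> K \<Longrightarrow> norm x \<le> R" "0 < R"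
    using compact_imp_bounded[OF K(1)] bounded_pos by blast
  have "R-lipschitz_on A (support_fun K)"
  proof (rule lipschitz_onI)
    fix u v
    show "dist (support_fun K u) (support_fun K v) \<le> R * dist u v"
      using support_fun_Lipschitz[OF K R(1), of u v] support_fun_Lipschitz[OF K R(1), of v u]
      by (simp add: dist_norm norm_minus_commute abs_le_iff)
  qed (use R in simp)
  then show ?thesis by (rule lipschitz_on_continuous_on)
qed

lemma integrable_continuous_surface_area:
  fixes f :: "real^2 \<Rightarrow> real"
  assumes "finite_measure (surface_area_measure K)" and f: "continuous_on (sphere 0 1) f"
  shows "integrable (surface_area_measure K) f"
proof -
  interpret finite_measure "surface_area_measure K" by fact
  have "bounded (f ` sphere 0 1)" by (intro compact_imp_bounded compact_continuous_image f) simp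
  then obtain B where "\<forall>y\<in>f ` sphere 0 1. norm y \<le> B" unfolding bounded_iff by blast
  then have B: "\<And>u. u \<in> sphere 0 1 \<Longrightarrow> norm (f u) \<le> B" by blast
  show ?thesis
  proof (rule integrable_const_bound[of _ B])
    show "AE u in surface_area_measure K. norm (f u) \<le> B" using B by (intro AE_I2) auto
    show "f \<in> borel_measurable (surface_area_measure K)"
      using borel_measurable_continuous_on_restrict[OF f] by (simp add: measurable_cong_sets[OF sets_surface_area refl])
  qed
qed

text \<open>
  The length of an edge of the inscribed polygon, projected onto the tangent direction at its
  first vertex.
\<close>

definition edge_length :: "(real^2) set \<Rightarrow> nat \<Rightarrow> nat \<Rightarrow> real" where
  "edge_length K m j = cross (dir (j * (pi / m))) (grid_point K m (Suc j) - grid_point K m j)"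

lemma grid_start:
  assumes L: "sym_body L"
  shows "start_point L (dir (j * (pi / m))) (grid_point L m j)"
    "start_point L (dir (j * (pi / m) + pi / m)) (grid_point L m (Suc j))"
proof -
  show "start_point L (dir (j * (pi / m))) (grid_point L m j)"
    unfolding grid_point_def by (rule start_of[OF L])
  have "real (Suc j) * (pi / m) = j * (pi / m) + pi / m"
    by (simp only: of_nat_Suc distrib_right mult_1 add.commute)
  then show "start_point L (dir (j * (pi / m) + pi / m)) (grid_point L m (Suc j))"
    using start_of[OF L, of "dir (Suc j * (pi / m))"] by (simp only: grid_point_def)
qed

lemma small_angle: "2 < m \<Longrightarrow> 0 < pi / real m \<and> pi / real m < pi / 2"
  by (simp add: field_simps)

lemma edge_length_nonneg: "sym_body K \<Longrightarrow> 2 < m \<Longrightarrow> 0 \<le> edge_length K m j"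
  unfolding edge_length_def using small_angle[of m] grid_start[of K]
  by (intro support_edge(1)[of "pi / m" K]) (auto simp: start_point_def)

lemma on_grid_arc:
  assumes L: "sym_body L" and R: "\<And>x. x \<in> L \<Longrightarrow> norm x \<le> R" and w: "w \<in> grid_arc m j"
  shows "support_fun L w \<le> support_fun L (dir (j * (pi / m))) + R * (pi / m)"
    "support_fun L (dir (j * (pi / m))) - R * (pi / m) \<le> support_fun L w"
proof -
  let ?u = "dir (j * (pi / m))"
  have n: "norm (w - ?u) \<le> pi / m"
    using arc_norm_diff[of w "j * (pi / m)" "j * (pi / m) + pi / m"] w by (simp add: grid_arc_def)
  have R0: "0 \<le> R" using R sym_body_nonempty[OF L] by (meson all_not_in_conv norm_ge_zero order_trans)
  note Lip = support_fun_Lipschitz[OF sym_body_compact[OF L] sym_body_nonempty[OF L] R]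
  show "support_fun L w \<le> support_fun L ?u + R * (pi / m)"
    using Lip[of w ?u] mult_left_mono[OF n R0] by linarith
  show "support_fun L ?u - R * (pi / m) \<le> support_fun L w"
    using Lip[of ?u w] mult_left_mono[OF n R0] by (simp add: norm_minus_commute)
qed

text \<open>
  Each edge of K occurs in the mixed sum together with two support points of L, whose heights over
  the edge are close to the support function of L. The sum runs over half of the circle, and the
  antipodal symmetry of all terms turns the factor 2 into a sum over the full circle.
\<close>

lemma grid_mixed_lower:
  assumes K: "sym_body K" and L: "sym_body L" and R: "\<And>x. x \<in> L \<Longrightarrow> norm x \<le> R" and m: "2 < m"
  shows "(\<Sum>j<2 * m. (support_fun L (dir (j * (pi / m))) - R * (2 * (pi / m) + tan (pi / m))) * edge_length K m j)
    \<le> grid_mixed K L m"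
proof -
  define \<alpha> where "\<alpha> = pi / real m"
  define h where "h j = support_fun L (dir (j * \<alpha>))" for j :: nat
  define x y where "x = grid_point K m" and "y = grid_point L m"
  define g where "g j = (h j - R * (2 * \<alpha> + tan \<alpha>)) * edge_length K m j" for j
  have al: "0 < \<alpha>" "\<alpha> < pi / 2" using small_angle[OF m] by (auto simp: \<alpha>_def)
  have tn: "0 \<le> tan \<alpha>" using al by (simp add: less_imp_le tan_gt_zero)
  have R0: "0 \<le> R" using R sym_body_nonempty[OF L] by (meson all_not_in_conv norm_ge_zero order_trans)
  have sx: "support_point K (dir (j * \<alpha>)) (x j)" "support_point K (dir (j * \<alpha> + \<alpha>)) (x (Suc j))"
    and sy: "support_point L (dir (j * \<alpha>)) (y j)" "support_point L (dir (j * \<alpha> + \<alpha>)) (y (Suc j))" for j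
    using grid_start[OF K, of j m] grid_start[OF L, of j m]
    by (auto simp: start_point_def \<alpha>_def x_def y_def)
  have el: "edge_length K m j = cross (dir (j * \<alpha>)) (x (Suc j) - x j)" for j
    by (simp add: edge_length_def \<alpha>_def x_def)
  have dd: "norm (dir (j * \<alpha>) - dir (j * \<alpha> + \<alpha>)) \<le> \<alpha>" for j
    using dir_diff_le[of "j * \<alpha>" "j * \<alpha> + \<alpha>"] al by simp
  have term_le: "2 * g j \<le> cross (y j) (x (Suc j) - x j) + cross (y (Suc j)) (x (Suc j) - x j)" for j
  proof -
    note e = support_edge[OF al sx(1,2)[of j]]
    have yL: "y j \<in> L" "y (Suc j) \<in> L" using sy[of j] by (auto simp: support_point_def)
    have 1: "h j - 2 * R * \<alpha> \<le> dir (j * \<alpha>) \<bullet> y j"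
      using support_fun_eq[OF sy(1)[of j]] R0 al by (simp add: h_def)
    have 2: "h j - 2 * R * \<alpha> \<le> dir (j * \<alpha>) \<bullet> y (Suc j)"
    proof -
      let ?u = "dir (j * \<alpha>)" and ?v = "dir (j * \<alpha> + \<alpha>)"
      have "h j \<le> support_fun L ?v + R * norm (?u - ?v)"
        unfolding h_def by (rule support_fun_Lipschitz[OF sym_body_compact[OF L] sym_body_nonempty[OF L] R])
      moreover have "R * norm (?u - ?v) \<le> R * \<alpha>" by (rule mult_left_mono[OF dd R0])
      moreover have "(?v - ?u) \<bullet> y (Suc j) \<le> norm (?v - ?u) * norm (y (Suc j))" by (rule norm_cauchy_schwarz)
      moreover have "norm (?v - ?u) * norm (y (Suc j)) \<le> \<alpha> * R"
        using dd[of j] R[OF yL(2)] al by (intro mult_mono) (auto simp: norm_minus_commute)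
      ultimately show ?thesis
        using support_fun_eq[OF sy(2)[of j]] by (simp add: inner_diff_left algebra_simps)
    qed
    have "g j \<le> cross (y j) (x (Suc j) - x j)" "g j \<le> cross (y (Suc j)) (x (Suc j) - x j)"
      using cross_edge_lower[OF e R[OF yL(1)] 1 tn] cross_edge_lower[OF e R[OF yL(2)] 2 tn]
      by (simp_all add: g_def el algebra_simps)
    then show ?thesis by simp
  qed
  have m0: "0 < m" using m by simp
  have period: "g (j + m) = g j" for j
  proof -
    have "real (j + m) * \<alpha> = j * \<alpha> + pi" using m by (simp add: \<alpha>_def field_simps)
    then have d: "dir (real (j + m) * \<alpha>) = - dir (j * \<alpha>)" by (simp only: dir_add_pi)
    have "x (Suc (j + m)) = - x (Suc j)" "x (j + m) = - x j"
      using grid_point_shift[OF K m0, of "Suc j"] grid_point_shift[OF K m0, of j] by (auto simp: x_def)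
    then have "edge_length K m (j + m) = edge_length K m j"
      unfolding el d by (simp add: coords algebra_simps)
    moreover have "h (j + m) = h j" unfolding h_def d by (rule support_fun_uminus[OF L])
    ultimately show ?thesis by (simp add: g_def)
  qed
  have "(\<Sum>j<2 * m. g j) = (\<Sum>j<m. g j) + (\<Sum>j<m. g (j + m))"
    using sum_lessThan_add[of g m m] by (simp only: mult_2)
  also have "\<dots> = (\<Sum>j<m. 2 * g j)" by (simp only: period sum.distrib mult_2)
  also have "\<dots> \<le> grid_mixed K L m"
    unfolding grid_mixed_eq[OF K L m0] x_def[symmetric] y_def[symmetric] by (rule sum_mono) (rule term_le)
  finally show ?thesis by (simp add: g_def h_def \<alpha>_def)
qed

lemma angle_tendsto: "(\<lambda>m. pi / real m) \<longlonglongrightarrow> 0"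
  by (rule lim_const_over_n)

lemma tan_angle_tendsto: "(\<lambda>m. tan (pi / real m)) \<longlonglongrightarrow> tan 0"
  by (rule isCont_tendsto_compose[OF _ angle_tendsto]) (simp add: isCont_tan)

locale hausdorff_surface =
  fixes K :: "(real^2) set"
  assumes K: "sym_body K"
    and surface: "\<And>\<omega>. \<omega> \<in> sets (restrict_space borel (sphere 0 1)) \<Longrightarrow>
      emeasure (surface_area_measure K) \<omega> = hausdorff_outer_measure 1 (gauss_preimage K \<omega>)"
begin

abbreviation "S \<equiv> surface_area_measure K"

lemma grid_arc_in_sets: "grid_arc m j \<in> sets S"
  by (simp add: grid_arc_def circle_arc_sets)

lemma emeasure_grid_arc_le:
  assumes m: "2 < m"
  shows "emeasure S (grid_arc m j) \<le> ennreal (edge_length K m j / cos (pi / m))"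
proof -
  have "emeasure S (grid_arc m j) = hausdorff_outer_measure 1 (gauss_preimage K (grid_arc m j))"
    by (rule surface) (simp add: grid_arc_def circle_arc_sets)
  also have "\<dots> \<le> ennreal (edge_length K m j / cos (pi / m))"
    unfolding grid_arc_def edge_length_def using small_angle[OF m]
    by (intro hausdorff_gauss_preimage_le sym_body_compact[OF K] grid_start[OF K]) auto
  finally show ?thesis .
qed

lemma finite_surface: "finite_measure S"
proof (rule finite_measureI)
  have m: "2 < (3::nat)" by simp
  have "emeasure S (space S) = emeasure S (\<Union>j<2 * 3. grid_arc 3 j)"
    by (subst grid_arc_cover) simp_all
  also have "\<dots> \<le> (\<Sum>j<2 * 3. emeasure S (grid_arc 3 j))"
    by (rule emeasure_subadditive_finite) (use grid_arc_in_sets in auto)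
  also have "\<dots> \<le> (\<Sum>j<2 * 3. ennreal (edge_length K 3 j / cos (pi / (3::nat))))"
    by (intro sum_mono emeasure_grid_arc_le m)
  also have "\<dots> < \<infinity>" by (simp add: ennreal_sum_less_top)
  finally show "emeasure S (space S) \<noteq> \<infinity>" by simp
qed

lemma measure_grid_arc_le:
  assumes m: "2 < m"
  shows "measure S (grid_arc m j) \<le> edge_length K m j / cos (pi / m)"
proof -
  interpret finite_measure S by (rule finite_surface)
  have "0 < cos (pi / m)" using small_angle[OF m] by (intro cos_gt_zero_pi) auto
  then show ?thesis
    using emeasure_grid_arc_le[OF m, of j] edge_length_nonneg[OF K m, of j]
    by (simp add: emeasure_eq_measure)
qed

text \<open>
  On each grid arc the support function is nearly constant, and the surface area measure of the arc
  is at most the length of the edge up to the factor cos. So the integral is bounded by the sum that is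
  dominated by the mixed sum, up to factors that tend to 1. The absolute errors of order \<pi> / m become
  such factors because the support function is at least r > 0.
\<close>

lemma integral_support_fun_le:
  assumes L: "sym_body L"
  shows "integral\<^sup>L S (support_fun L) \<le> 2 * mixed_area L K"
proof -
  obtain r R where r: "0 < r" "cball 0 r \<subseteq> L" and R: "0 < R" "\<And>x. x \<in> L \<Longrightarrow> norm x \<le> R"
    using sym_body_radii[OF L] by metis
  define I where "I = integral\<^sup>L S (support_fun L)"
  have int: "integrable S (support_fun L)"
    by (intro integrable_continuous_surface_area finite_surface continuous_on_support_fun
        sym_body_compact[OF L] sym_body_nonempty[OF L])
  define p where "p t = 1 - R * (2 * t + tan t) / r" for t
  have lim_p: "(\<lambda>m. p (pi / real m)) \<longlonglongrightarrow> 1"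
  proof -
    have "(\<lambda>m. p (pi / real m)) \<longlonglongrightarrow> 1 - R * (2 * 0 + tan 0) / r"
      unfolding p_def by (intro tendsto_intros angle_tendsto tan_angle_tendsto) (use r in auto)
    then show ?thesis by simp
  qed
  have bound: "p (pi / m) * cos (pi / m) * I \<le> (1 + R * (pi / m) / r) * grid_mixed K L m"
    if m: "2 < m" and p0: "0 < p (pi / m)" for m
  proof -
    define \<alpha> where "\<alpha> = pi / real m"
    have al: "0 < \<alpha>" "\<alpha> < pi / 2" using small_angle[OF m] by (auto simp: \<alpha>_def)
    have ct: "0 < cos \<alpha>" using al by (intro cos_gt_zero_pi) auto
    have tn: "0 \<le> tan \<alpha>" using al by (simp add: less_imp_le tan_gt_zero)
    define h where "h j = support_fun L (dir (j * \<alpha>))" for j :: nat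
    define Q where "Q = (\<Sum>j<2 * m. h j * edge_length K m j)"
    have hr: "r \<le> h j" for j
      unfolding h_def using r by (intro support_fun_lower sym_body_compact[OF L]) auto
    have "I \<le> (\<Sum>j<2 * m. (h j + R * \<alpha>) * measure S (grid_arc m j))"
      unfolding I_def
    proof (rule integral_partition_bounds(1)[OF finite_surface int])
      show "(\<Union>j<2 * m. grid_arc m j) = space S" using grid_arc_cover[of m] m by simp
      show "support_fun L w \<le> h j + R * \<alpha>" if "w \<in> grid_arc m j" for j w
        using on_grid_arc(1)[OF L R(2) that] by (simp add: h_def \<alpha>_def)
    qed (use grid_arc_in_sets grid_arc_disjoint m in auto)
    also have "\<dots> \<le> (\<Sum>j<2 * m. (1 + R * \<alpha> / r) * h j * (edge_length K m j / cos \<alpha>))"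
    proof (rule sum_mono, rule mult_mono)
      fix j
      have "R * \<alpha> * 1 \<le> R * \<alpha> * (h j / r)" using hr[of j] r R al by (intro mult_left_mono) auto
      then show "h j + R * \<alpha> \<le> (1 + R * \<alpha> / r) * h j" by (simp add: algebra_simps)
      show "0 \<le> (1 + R * \<alpha> / r) * h j" using R r al hr[of j] by auto
      show "measure S (grid_arc m j) \<le> edge_length K m j / cos \<alpha>"
        unfolding \<alpha>_def by (rule measure_grid_arc_le[OF m])
    qed simp
    also have "\<dots> = (1 + R * \<alpha> / r) * Q / cos \<alpha>"
      by (simp add: Q_def sum_distrib_left sum_divide_distrib mult.assoc)
    finally have I_le: "cos \<alpha> * I \<le> (1 + R * \<alpha> / r) * Q" using ct by (simp add: field_simps)
    have "p \<alpha> * Q = (\<Sum>j<2 * m. p \<alpha> * h j * edge_length K m j)"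
      by (simp add: Q_def sum_distrib_left mult.assoc)
    also have "\<dots> \<le> (\<Sum>j<2 * m. (h j - R * (2 * \<alpha> + tan \<alpha>)) * edge_length K m j)"
    proof (rule sum_mono, rule mult_right_mono)
      fix j
      have "R * (2 * \<alpha> + tan \<alpha>) * 1 \<le> R * (2 * \<alpha> + tan \<alpha>) * (h j / r)"
        using hr[of j] r R al tn by (intro mult_left_mono) auto
      then show "p \<alpha> * h j \<le> h j - R * (2 * \<alpha> + tan \<alpha>)" by (simp add: p_def left_diff_distrib)
    qed (rule edge_length_nonneg[OF K m])
    also have "\<dots> \<le> grid_mixed K L m"
      using grid_mixed_lower[OF K L R(2) m] by (simp add: h_def \<alpha>_def)
    finally have Q_le: "p \<alpha> * Q \<le> grid_mixed K L m" .
    have "p \<alpha> * (cos \<alpha> * I) \<le> p \<alpha> * ((1 + R * \<alpha> / r) * Q)"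
      using p0 I_le by (intro mult_left_mono) (auto simp: \<alpha>_def)
    also have "\<dots> = (1 + R * \<alpha> / r) * (p \<alpha> * Q)" by simp
    also have "\<dots> \<le> (1 + R * \<alpha> / r) * grid_mixed K L m"
      using Q_le R r al by (intro mult_left_mono) auto
    finally show ?thesis by (simp add: \<alpha>_def mult.assoc)
  qed
  have "1 * cos 0 * I \<le> (1 + R * 0 / r) * (2 * mixed_area L K)"
  proof (rule tendsto_le[OF sequentially_bot])
    show "(\<lambda>m. (1 + R * (pi / m) / r) * grid_mixed K L m) \<longlonglongrightarrow> (1 + R * 0 / r) * (2 * mixed_area L K)"
      by (intro tendsto_intros angle_tendsto grid_mixed_tendsto K L) (use r in auto)
    show "(\<lambda>m. p (pi / real m) * cos (pi / m) * I) \<longlonglongrightarrow> 1 * cos 0 * I"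
      by (intro tendsto_intros angle_tendsto lim_p)
    show "\<forall>\<^sub>F m in sequentially. p (pi / real m) * cos (pi / real m) * I \<le> (1 + R * (pi / m) / r) * grid_mixed K L m"
      using eventually_gt_at_top[of 2] order_tendstoD(1)[OF lim_p, of 0, simplified]
      by eventually_elim (rule bound)
  qed
  then show ?thesis by (simp add: I_def)
qed

text \<open>
  K is covered by the cones over its regular boundary points and by a null set: the cone over the
  countably many other boundary points and the origin. The number \<eta> is the slack in the choice of the
  coverings.
\<close>

lemma vol_le_cone_sum:
  fixes h g :: "nat \<Rightarrow> real"
  assumes R: "\<And>x. x \<in> K \<Longrightarrow> norm x \<le> R" and R0: "0 \<le> R" and m: "2 < m"
    and h: "\<And>j. h j = support_fun K (dir (j * (pi / m)))"
    and g: "\<And>j. g j = h j - 2 * R * (pi / m)" "\<And>j. 0 < g j" and \<eta>: "0 < \<eta>"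
  shows "vol K \<le> (\<Sum>j<2 * m. h j / 2 * (h j / g j * (1 + R * tan (pi / m) / g j)) * (measure S (grid_arc m j) + \<eta>))"
proof -
  interpret finite_measure S by (rule finite_surface)
  define c where "c j = h j / 2 * (h j / g j * (1 + R * tan (pi / m) / g j)) * (measure S (grid_arc m j) + \<eta>)" for j
  note al = small_angle[OF m]
  have tn: "0 \<le> tan (pi / m)" using al by (simp add: less_imp_le tan_gt_zero)
  have h0: "0 < h j" for j using g(1)[of j] g(2)[of j] R0 al by (smt (verit) mult_nonneg_nonneg)
  have c0: "0 \<le> c j" for j
    unfolding c_def using h0[of j] g(2)[of j] R0 tn \<eta> by (intro mult_nonneg_nonneg divide_nonneg_nonneg add_nonneg_nonneg) auto
  have "\<exists>M. M \<in> sets borel \<and> radial_hull (gauss_preimage K (grid_arc m j)) \<subseteq> M \<and> emeasure lborel M \<le> ennreal (c j)" for j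
  proof -
    have "hausdorff_outer_measure 1 (gauss_preimage K (grid_arc m j)) = emeasure S (grid_arc m j)"
      by (rule surface[symmetric]) (simp add: grid_arc_def circle_arc_sets)
    then have "hausdorff_outer_measure 1 (gauss_preimage K (grid_arc m j)) = ennreal (measure S (grid_arc m j))"
      by (simp add: emeasure_eq_measure)
    from cone_cover[OF K R _ _ h g(1) g(2) this[unfolded grid_arc_def] measure_nonneg \<eta> R0] al
    show ?thesis unfolding c_def grid_arc_def by metis
  qed
  then obtain M where M: "\<And>j. M j \<in> sets borel" "\<And>j. radial_hull (gauss_preimage K (grid_arc m j)) \<subseteq> M j"
    "\<And>j. emeasure lborel (M j) \<le> ennreal (c j)" by metis
  define N where "N = insert 0 (radial_hull (frontier K - regular_boundary K))"
  have N: "negligible N" unfolding N_def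
    by (simp add: negligible_cone_countable[OF countable_nonregular[OF K]])
  have "K \<subseteq> N \<union> (\<Union>j<2 * m. M j)"
  proof
    fix z assume z: "z \<in> K"
    show "z \<in> N \<union> (\<Union>j<2 * m. M j)"
    proof (cases "z \<in> N")
      case False
      then have "z \<in> radial_hull (frontier K)" using z body_subset_cone_frontier[OF K] by (auto simp: N_def)
      then obtain s p where sp: "0 \<le> s" "s \<le> 1" "p \<in> frontier K" "z = s *\<^sub>R p" by (auto simp: radial_hull_def)
      have p: "p \<in> regular_boundary K"
      proof (rule ccontr)
        assume "p \<notin> regular_boundary K"
        then have "z \<in> N" using sp by (auto simp: N_def radial_hull_def)
        then show False using False by simp
      qed
      then have "gauss_map K p \<in> sphere 0 1" using gauss_map_normal[OF p] by (simp add: outer_unit_normal_def)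
      then have "gauss_map K p \<in> (\<Union>j<2 * m. grid_arc m j)" using m by (subst grid_arc_cover) auto
      then obtain j where j: "j < 2 * m" "gauss_map K p \<in> grid_arc m j" by blast
      then have "z \<in> radial_hull (gauss_preimage K (grid_arc m j))"
        using sp p by (auto simp: radial_hull_def gauss_preimage_def)
      then show ?thesis using M(2) j by blast
    qed simp
  qed
  moreover have "(\<Union>j<2 * m. M j) \<in> sets lebesgue" using M(1) by auto
  moreover have "N \<in> sets lebesgue" by (rule negligible_imp_sets[OF N])
  ultimately have "emeasure lebesgue K \<le> emeasure lebesgue (N \<union> (\<Union>j<2 * m. M j))"
    by (intro emeasure_mono) auto
  also have "\<dots> \<le> emeasure lebesgue N + emeasure lebesgue (\<Union>j<2 * m. M j)"
    using M(1) negligible_imp_sets[OF N] by (intro emeasure_subadditive) auto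
  also have "emeasure lebesgue N = 0" using N unfolding negligible_iff_null_sets by (rule null_setsD1)
  also have "emeasure lebesgue (\<Union>j<2 * m. M j) \<le> (\<Sum>j<2 * m. emeasure lebesgue (M j))"
    using M(1) by (intro emeasure_subadditive_finite) auto
  also have "\<dots> = (\<Sum>j<2 * m. emeasure lborel (M j))" using M(1) by (intro sum.cong) auto
  also have "\<dots> \<le> (\<Sum>j<2 * m. ennreal (c j))" using M(3) by (intro sum_mono)
  also have "\<dots> = ennreal (\<Sum>j<2 * m. c j)" using c0 by (simp add: sum_ennreal)
  finally have "emeasure lebesgue K \<le> ennreal (\<Sum>j<2 * m. c j)" by simp
  then have "vol K \<le> (\<Sum>j<2 * m. c j)"
    unfolding measure_def using c0 by (intro enn2real_leI) (auto intro: sum_nonneg)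
  then show ?thesis by (simp add: c_def)
qed

text \<open>
  The cone over the boundary points with normals in a grid arc has area at most half the support
  function times the surface area measure of the arc, up to a factor F that tends to 1.
\<close>

lemma vol_le_integral_support_fun: "2 * vol K \<le> integral\<^sup>L S (support_fun K)"
proof -
  obtain r R where r: "0 < r" "cball 0 r \<subseteq> K" and R: "0 < R" "\<And>x. x \<in> K \<Longrightarrow> norm x \<le> R"
    using sym_body_radii[OF K] by metis
  define I where "I = integral\<^sup>L S (support_fun K)"
  have int: "integrable S (support_fun K)"
    by (intro integrable_continuous_surface_area finite_surface continuous_on_support_fun
        sym_body_compact[OF K] sym_body_nonempty[OF K])
  define q where "q t = r - 2 * R * t" for t
  define F where "F t = r / q t * (1 + R * tan t / q t)" for t
  have lim_q: "(\<lambda>m. q (pi / real m)) \<longlonglongrightarrow> r"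
  proof -
    have "(\<lambda>m. q (pi / real m)) \<longlonglongrightarrow> r - 2 * R * 0"
      unfolding q_def by (intro tendsto_intros angle_tendsto)
    then show ?thesis by simp
  qed
  have lim_F: "(\<lambda>m. F (pi / real m)) \<longlonglongrightarrow> 1"
  proof -
    have "(\<lambda>m. F (pi / real m)) \<longlonglongrightarrow> r / r * (1 + R * tan 0 / r)"
      unfolding F_def by (intro tendsto_intros angle_tendsto tan_angle_tendsto lim_q) (use r in auto)
    then show ?thesis using r by simp
  qed
  have bound: "(1 - R * (pi / m) / r) * (2 * vol K) \<le> F (pi / m) * I"
    if m: "2 < m" and q0: "0 < q (pi / m)" for m :: nat
  proof -
    interpret finite_measure S by (rule finite_surface)
    define \<alpha> where "\<alpha> = pi / real m"
    have al: "0 < \<alpha>" "\<alpha> < pi / 2" using small_angle[OF m] by (auto simp: \<alpha>_def)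
    have tn: "0 \<le> tan \<alpha>" using al by (simp add: less_imp_le tan_gt_zero)
    have q0: "0 < q \<alpha>" using q0 by (simp add: \<alpha>_def)
    define h where "h j = support_fun K (dir (j * (pi / m)))" for j :: nat
    define g where "g j = h j - 2 * R * (pi / m)" for j
    define H where "H j = measure S (grid_arc m j)" for j
    have hr: "r \<le> h j" for j
      unfolding h_def using r by (intro support_fun_lower sym_body_compact[OF K]) auto
    have gq: "q \<alpha> \<le> g j" for j using hr[of j] by (simp add: g_def q_def \<alpha>_def)
    have g0: "0 < g j" for j using gq[of j] q0 by linarith
    define c where "c j = h j / 2 * (h j / g j * (1 + R * tan (pi / m) / g j))" for j
    have F0: "0 \<le> F \<alpha>" unfolding F_def using r q0 R tn by auto
    have c_le: "c j \<le> h j / 2 * F \<alpha>" for j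
      unfolding c_def F_def
    proof (intro mult_left_mono mult_mono)
      have "2 * R * \<alpha> * r \<le> 2 * R * \<alpha> * h j" using hr[of j] R al by (intro mult_left_mono) auto
      then have "h j * q \<alpha> \<le> r * g j"
        unfolding g_def q_def \<alpha>_def[symmetric] by (simp add: algebra_simps)
      then show "h j / g j \<le> r / q \<alpha>"
        using g0[of j] q0 by (simp add: field_simps)
      show "1 + R * tan (pi / m) / g j \<le> 1 + R * tan \<alpha> / q \<alpha>"
        unfolding \<alpha>_def[symmetric] using gq[of j] q0 R tn by (intro add_left_mono divide_left_mono) auto
      show "0 \<le> 1 + R * tan (pi / m) / g j"
        unfolding \<alpha>_def[symmetric] using g0[of j] R tn by auto
    qed (use r q0 hr[of j] in auto)
    have "vol K \<le> (\<Sum>j<2 * m. c j * H j) + \<eta>'" if "0 < \<eta>'" for \<eta>'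
    proof -
      define C where "C = (\<Sum>j<2 * m. c j)"
      have c0: "0 \<le> c j" for j unfolding c_def \<alpha>_def[symmetric] using g0[of j] hr[of j] r R tn
        by (intro mult_nonneg_nonneg divide_nonneg_nonneg add_nonneg_nonneg) auto
      have C0: "0 \<le> C" unfolding C_def using c0 by (intro sum_nonneg) auto
      \<comment> \<open>The added 1 avoids a division by zero.\<close>
      define \<eta> where "\<eta> = \<eta>' / (C + 1)"
      have \<eta>: "0 < \<eta>" using that C0 by (simp add: \<eta>_def)
      have "vol K \<le> (\<Sum>j<2 * m. c j * (H j + \<eta>))"
        unfolding c_def H_def
        by (rule vol_le_cone_sum[OF R(2) less_imp_le[OF R(1)] m h_def g_def g0 \<eta>])
      also have "\<dots> = (\<Sum>j<2 * m. c j * H j) + C * \<eta>"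
        by (simp add: distrib_left sum.distrib C_def sum_distrib_right)
      also have "C * \<eta> \<le> \<eta>'"
        using that C0 by (simp add: \<eta>_def field_simps)
      finally show ?thesis by simp
    qed
    then have "vol K \<le> (\<Sum>j<2 * m. c j * H j)" by (rule field_le_epsilon)
    also have "\<dots> \<le> (\<Sum>j<2 * m. h j / 2 * F \<alpha> * H j)"
      using c_le by (intro sum_mono mult_right_mono) (auto simp: H_def)
    also have "\<dots> = F \<alpha> / 2 * (\<Sum>j<2 * m. h j * H j)" by (simp add: sum_distrib_left mult_ac)
    finally have v: "2 * vol K \<le> F \<alpha> * (\<Sum>j<2 * m. h j * H j)" by simp
    have s: "0 \<le> 1 - R * \<alpha> / r"
      using q0 r R al by (simp add: q_def field_simps)
    have "(1 - R * \<alpha> / r) * (\<Sum>j<2 * m. h j * H j) = (\<Sum>j<2 * m. (1 - R * \<alpha> / r) * h j * H j)"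
      by (simp add: sum_distrib_left mult.assoc)
    also have "\<dots> \<le> (\<Sum>j<2 * m. (h j - R * \<alpha>) * H j)"
    proof (rule sum_mono, rule mult_right_mono)
      fix j
      have "R * \<alpha> * 1 \<le> R * \<alpha> * (h j / r)" using hr[of j] r R al by (intro mult_left_mono) auto
      then show "(1 - R * \<alpha> / r) * h j \<le> h j - R * \<alpha>" by (simp add: left_diff_distrib)
    qed (simp add: H_def)
    also have "\<dots> \<le> I"
      unfolding I_def H_def
    proof (rule integral_partition_bounds(2)[OF finite_surface int])
      show "(\<Union>j<2 * m. grid_arc m j) = space S" using grid_arc_cover[of m] m by simp
      show "h j - R * \<alpha> \<le> support_fun K w" if "w \<in> grid_arc m j" for j w
        using on_grid_arc(2)[OF K R(2) that] by (simp add: h_def \<alpha>_def)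
    qed (use grid_arc_in_sets grid_arc_disjoint m in auto)
    finally have i: "(1 - R * \<alpha> / r) * (\<Sum>j<2 * m. h j * H j) \<le> I" .
    have "(1 - R * \<alpha> / r) * (2 * vol K) \<le> (1 - R * \<alpha> / r) * (F \<alpha> * (\<Sum>j<2 * m. h j * H j))"
      by (rule mult_left_mono[OF v s])
    also have "\<dots> = F \<alpha> * ((1 - R * \<alpha> / r) * (\<Sum>j<2 * m. h j * H j))" by simp
    also have "\<dots> \<le> F \<alpha> * I" by (rule mult_left_mono[OF i F0])
    finally show ?thesis by (simp add: \<alpha>_def)
  qed
  have "(1 - R * 0 / r) * (2 * vol K) \<le> 1 * I"
  proof (rule tendsto_le[OF sequentially_bot])
    show "(\<lambda>m. F (pi / real m) * I) \<longlonglongrightarrow> 1 * I" by (intro tendsto_intros lim_F)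
    show "(\<lambda>m. (1 - R * (pi / real m) / r) * (2 * vol K)) \<longlonglongrightarrow> (1 - R * 0 / r) * (2 * vol K)"
      by (intro tendsto_intros angle_tendsto) (use r in auto)
    show "\<forall>\<^sub>F m in sequentially. (1 - R * (pi / real m) / r) * (2 * vol K) \<le> F (pi / real m) * I"
      using eventually_gt_at_top[of 2] order_tendstoD(1)[OF lim_q r(1)]
      by eventually_elim (rule bound)
  qed
  then show ?thesis by (simp add: I_def)
qed

end

section \<open>The local logarithmic Brunn-Minkowski inequality\<close>

theorem theorem4p1:
  fixes K L :: "(real^2) set"
  assumes "convex_body K" and "centrally_symmetric K"
    and "convex_body L" and "centrally_symmetric L"
  shows "vol K * (2 * vol L
           + (\<integral>u. (support_fun L u)\<^sup>2 / support_fun K u \<partial>surface_area_measure K))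
         - 4 * (mixed_area L K)\<^sup>2 \<le> 0"
proof -
  have K: "sym_body K" and L: "sym_body L" using assms by (auto simp: sym_body_def)
  define V where "V = mixed_area L K"
  have V0: "0 \<le> V" unfolding V_def by (rule mixed_area_nonneg[OF K L])
  define J where "J = (\<integral>u. (support_fun L u)\<^sup>2 / support_fun K u \<partial>surface_area_measure K)"
  have "vol K * (2 * vol L + J) \<le> 4 * V\<^sup>2"
  proof (rule surface_area_measure_cases[of K])
    assume "\<And>\<omega>. emeasure (surface_area_measure K) \<omega> = 0"
    then have "AE u in surface_area_measure K. (support_fun L u)\<^sup>2 / support_fun K u = 0"
      by (intro AE_I[OF _ _ sets.top]) auto
    then have "J = 0" unfolding J_def by (rule integral_eq_zero_AE)
    then have "vol K * (2 * vol L + J) = 2 * (vol K * vol L)" by simp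
    also have "\<dots> \<le> 2 * V\<^sup>2"
      unfolding V_def by (intro mult_left_mono Minkowski_inequality_symmetric K L) simp
    also have "\<dots> \<le> 4 * V\<^sup>2" by simp
    finally show ?thesis .
  next
    assume "\<And>\<omega>. \<omega> \<in> sets (restrict_space borel (sphere 0 1)) \<Longrightarrow>
      emeasure (surface_area_measure K) \<omega> = hausdorff_outer_measure 1 (gauss_preimage K \<omega>)"
    then interpret hausdorff_surface K using K by unfold_locales auto
    have cont: "continuous_on (sphere 0 1) (support_fun K)" "continuous_on (sphere 0 1) (support_fun L)"
      by (intro continuous_on_support_fun sym_body_compact sym_body_nonempty K L)+
    have pos: "0 < support_fun K u" if "u \<in> sphere 0 1" for u
      using support_fun_pos[OF K] that by simp
    have int: "integrable S (support_fun K)" "integrable S (support_fun L)"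
      by (intro integrable_continuous_surface_area finite_surface cont)+
    have int2: "integrable S (\<lambda>u. (support_fun L u)\<^sup>2 / support_fun K u)"
      using pos by (intro integrable_continuous_surface_area finite_surface continuous_intros cont) force
    have "vol K * J = (\<integral>u. vol K * ((support_fun L u)\<^sup>2 / support_fun K u) \<partial>S)"
      unfolding J_def by (rule integral_mult_right_zero[symmetric])
    also have "\<dots> \<le> (\<integral>u. 2 * V * support_fun L u - vol L * support_fun K u \<partial>S)"
    proof (rule integral_mono)
      fix u assume u: "u \<in> space S"
      define a b where "a = support_fun K u" and "b = support_fun L u"
      have a: "0 < a" using pos u by (simp add: a_def)
      have "a\<^sup>2 * vol L + b\<^sup>2 * vol K \<le> 2 * a * b * V"
        unfolding V_def using u by (intro Bonnesen_symmetric[OF K L, of u]) (auto simp: a_def b_def)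
      then have "vol K * (b\<^sup>2 / a) \<le> 2 * V * b - vol L * a"
        using a by (simp add: field_simps power2_eq_square)
      then show "vol K * ((support_fun L u)\<^sup>2 / support_fun K u) \<le> 2 * V * support_fun L u - vol L * support_fun K u"
        by (simp add: a_def b_def)
    qed (intro integrable_mult_right int2 Bochner_Integration.integrable_diff int)+
    also have "\<dots> = 2 * V * integral\<^sup>L S (support_fun L) - vol L * integral\<^sup>L S (support_fun K)"
      using int by simp
    also have "\<dots> \<le> 2 * V * (2 * V) - vol L * (2 * vol K)"
      using V0 integral_support_fun_le[OF L] vol_le_integral_support_fun
      by (intro diff_mono mult_left_mono) (auto simp: V_def)
    finally show ?thesis by (simp add: power2_eq_square algebra_simps)
  qed
  then show ?thesis by (simp add: V_def J_def)
qed

end
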